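(* Let $n\ge 1$ and $w\in S_n$. The map $\mathrm{chain}_{\mathrm{BPD}}$ is a bijection from $\mathrm{BPD}(w)$ to the set of chains from $w$ to $w_0$ that are compatible with $(n-1,n-2,\dots,1)$. Moreover, if $\mathrm{chain}_{\mathrm{BPD}}(D)=C$, then $\mathrm{wt}(C)$ is the reverse of the sequence $(n-1,n-2,\dots,1)-\mathrm{wt}(D)$.
   Context: Permutations are written in one-line notation; $w_0=[n,n-1,\dots,1]$; $[m]=\{1,\dots,m\}$. For $i<j$, $t_{i,j}$ is the transposition of $i,j$, and $wt_{i,j}$ is $w$ with the entries in positions $i$ and $j$ exchanged. $\ell(w)$ is the number of inversions of $w$. Bruhat covers: $u\lessdot w$ iff $w=ut_{i,j}$ for some $i<j$ and $\ell(w)=\ell(u)+1$. For $k\in[n-1]$, $u\lessdot_k w$ iff $u\lessdot w$ and $w=ut_{i,j}$ with $i\le k<j$. A $k$-chain $v_1\lessdot_k v_2\lessdot_k\cdots\lessdot_k v_d$ ($d\ge 1$; $d=1$ allowed) is increasing if, writing $v_{s+1}=v_st_{i_s,j_s}$, the smaller of the two values exchanged at step $s$ strictly increases with $s$. A sequence $(w_1,\dots,w_d)$ of permutations is compatible with $(k_1,\dots,k_{d-1})$ if for each $s\in[d-1]$ there is an increasing $k_s$-chain from $w_s$ to $w_{s+1}$; it is then a chain from $w_1$ to $w_d$, and its weight is $\mathrm{wt}(w_1,\dots,w_d)=(\ell(w_2)-\ell(w_1),\dots,\ell(w_d)-\ell(w_{d-1}))$. For $k\in\{0,\dots,n-1\}$,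 $S_n^{k\searrow}=\{u\in S_n: u(k+1)>u(k+2)>\dots>u(n)\}$. Bumpless pipe dreams: cells are indexed by matrix coordinates (row 1 on top, column 1 on the left). Tiles are of six types: blank, cross (a horizontal and a vertical pipe crossing), horizontal segment, vertical segment, an elbow joining the right edge and the bottom edge, and an elbow joining the top edge and the left edge. A $k$-row BPD ($0\le k\le n$) is a filling of a $k\times n$ grid by these tiles such that pipe segments match across shared edges, no pipe crosses the left boundary or top boundary of the grid, each of the $k$ cells in column $n$ has a pipe entering through its right edge, and any two pipes cross at most once. Then the $k$ pipes exit through the bottom edge of row $k$ in distinct columns; the $k$-row BPD is associated with the unique $u\in S_n^{k\searrow}$ such that, for $i\in[k]$, $u(i)$ is the column where the pipe entering row $i$ exits the bottom of row $k$. A bumpless pipe dream (BPD) for $w\in S_n$ is an $n$-row BPD associated with $w$ (so every column has a pipe exiting the bottom of row $n$); $\mathrm{BPD}(w)$ is the set of these. The weight $\mathrm{wt}(D)$ of a BPD $D$ is the sequence of length $n-1$ whose $i$-th entry is the number of blank tiles in row $i$. For $D\in\mathrm{BPD}(w)$ and $k=0,\dots,n-1$, let $u_k$ be the permutation associated with the $k$-row BPD formed by the first $k$ rows of $D$. Define $\mathrm{chain}_{\mathrm{BPD}}(D)=(u_{n-1},u_{n-2},\dots,u_0)$. *)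

theory Defs
  imports "HOL-Combinatorics.Combinatorics"
begin

definition perm_len :: "nat \<Rightarrow> (nat \<Rightarrow> nat) \<Rightarrow> nat" where
  "perm_len n w = card {(i, j). 1 \<le> i \<and> i < j \<and> j \<le> n \<and> w i > w j}"

definition w0 :: "nat \<Rightarrow> nat \<Rightarrow> nat" where
  "w0 n = (\<lambda>i. if 1 \<le> i \<and> i \<le> n then n + 1 - i else i)"

definition inc_kchain :: "nat \<Rightarrow> nat \<Rightarrow> (nat \<Rightarrow> nat) list \<Rightarrow> bool" where
  "inc_kchain n k vs \<longleftrightarrow> vs \<noteq> [] \<and> (\<forall>v\<in>set vs. v permutes {1..n}) \<and>
     (\<exists>is js. length is = length vs - 1 \<and> length js = length vs - 1 \<and>
        (\<forall>s < length vs - 1. 1 \<le> is!s \<and> is!s \<le> k \<and> k < js!s \<and> js!s \<le> n \<and>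
            vs!(s+1) = vs!s \<circ> Transposition.transpose (is!s) (js!s) \<and>
            perm_len n (vs!(s+1)) = perm_len n (vs!s) + 1) \<and>
        (\<forall>s. s + 1 < length vs - 1 \<longrightarrow>
            min ((vs!s) (is!s)) ((vs!s) (js!s)) < min ((vs!(s+1)) (is!(s+1))) ((vs!(s+1)) (js!(s+1)))))"

definition compatible :: "nat \<Rightarrow> (nat \<Rightarrow> nat) list \<Rightarrow> nat list \<Rightarrow> bool" where
  "compatible n ws ks \<longleftrightarrow> length ws = length ks + 1 \<and> (\<forall>v\<in>set ws. v permutes {1..n}) \<and>
     (\<forall>s < length ks. \<exists>vs. inc_kchain n (ks!s) vs \<and> hd vs = ws!s \<and> last vs = ws!(s+1))"

definition chain_wt :: "nat \<Rightarrow> (nat \<Rightarrow> nat) list \<Rightarrow> int list" where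
  "chain_wt n ws = map (\<lambda>s. int (perm_len n (ws!(s+1))) - int (perm_len n (ws!s))) [0..<length ws - 1]"

definition chains_to_w0 :: "nat \<Rightarrow> (nat \<Rightarrow> nat) \<Rightarrow> (nat \<Rightarrow> nat) list set" where
  "chains_to_w0 n w = {ws. compatible n ws (rev [1..<n]) \<and> hd ws = w \<and> last ws = w0 n}"

definition Sdec :: "nat \<Rightarrow> nat \<Rightarrow> (nat \<Rightarrow> nat) set" where
  "Sdec n k = {u. u permutes {1..n} \<and> (\<forall>i j. k + 1 \<le> i \<longrightarrow> i < j \<longrightarrow> j \<le> n \<longrightarrow> u i > u j)}"

datatype tile = Blank | Cross | Horiz | Vert | ElbowRB | ElbowTL

fun has_left :: "tile \<Rightarrow> bool" where
  "has_left Cross = True" | "has_left Horiz = True" | "has_left ElbowTL = True" | "has_left _ = False"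
fun has_right :: "tile \<Rightarrow> bool" where
  "has_right Cross = True" | "has_right Horiz = True" | "has_right ElbowRB = True" | "has_right _ = False"
fun has_top :: "tile \<Rightarrow> bool" where
  "has_top Cross = True" | "has_top Vert = True" | "has_top ElbowTL = True" | "has_top _ = False"
fun has_bot :: "tile \<Rightarrow> bool" where
  "has_bot Cross = True" | "has_bot Vert = True" | "has_bot ElbowRB = True" | "has_bot _ = False"

text \<open>A filling: D r c is the tile in row r, column c (matrix coordinates, 1-based);
  cells outside the k x n grid are Blank (canonical representation).\<close>
type_synonym filling = "nat \<Rightarrow> nat \<Rightarrow> tile"

datatype dir = FromRight | FromTop

text \<open>Pipe state (r, c, d): the pipe enters cell (r,c) through edge d.
  A pipe exiting the bottom of row k is in a state with r = k+1, where it stays.\<close>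
definition pstep :: "nat \<Rightarrow> filling \<Rightarrow> nat \<times> nat \<times> dir \<Rightarrow> nat \<times> nat \<times> dir" where
  "pstep k D st = (case st of (r, c, d) \<Rightarrow>
     if 1 \<le> r \<and> r \<le> k \<and> 1 \<le> c then
       (case d of
          FromRight \<Rightarrow> (case D r c of Horiz \<Rightarrow> (r, c - 1, FromRight) | Cross \<Rightarrow> (r, c - 1, FromRight)
                         | ElbowRB \<Rightarrow> (r + 1, c, FromTop) | _ \<Rightarrow> (r, c, d))
        | FromTop \<Rightarrow> (case D r c of Vert \<Rightarrow> (r + 1, c, FromTop) | Cross \<Rightarrow> (r + 1, c, FromTop)
                         | ElbowTL \<Rightarrow> (r, c - 1, FromRight) | _ \<Rightarrow> (r, c, d)))
     else (r, c, d))"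

definition pipe_state :: "nat \<Rightarrow> nat \<Rightarrow> filling \<Rightarrow> nat \<Rightarrow> nat \<Rightarrow> nat \<times> nat \<times> dir" where
  "pipe_state n k D i t = (pstep k D ^^ t) (i, n, FromRight)"

definition pipe_cells :: "nat \<Rightarrow> nat \<Rightarrow> filling \<Rightarrow> nat \<Rightarrow> (nat \<times> nat) set" where
  "pipe_cells n k D i = {(r, c). \<exists>t. fst (pipe_state n k D i t) = r \<and> fst (snd (pipe_state n k D i t)) = c
                                      \<and> 1 \<le> r \<and> r \<le> k}"

text \<open>Column at which the pipe entering row i exits the bottom of row k (path has < k+n steps).\<close>
definition pipe_exit :: "nat \<Rightarrow> nat \<Rightarrow> filling \<Rightarrow> nat \<Rightarrow> nat" where
  "pipe_exit n k D i = fst (snd (pipe_state n k D i (k + n)))"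

definition crossings :: "nat \<Rightarrow> nat \<Rightarrow> filling \<Rightarrow> nat \<Rightarrow> nat \<Rightarrow> (nat \<times> nat) set" where
  "crossings n k D i j = {(r, c). D r c = Cross \<and> (r, c) \<in> pipe_cells n k D i \<inter> pipe_cells n k D j}"

definition kBPD :: "nat \<Rightarrow> nat \<Rightarrow> filling \<Rightarrow> bool" where
  "kBPD n k D \<longleftrightarrow>
     (\<forall>r c. \<not> (1 \<le> r \<and> r \<le> k \<and> 1 \<le> c \<and> c \<le> n) \<longrightarrow> D r c = Blank) \<and>
     (\<forall>r\<in>{1..k}. \<forall>c\<in>{1..<n}. has_right (D r c) = has_left (D r (c + 1))) \<and>
     (\<forall>r\<in>{1..<k}. \<forall>c\<in>{1..n}. has_bot (D r c) = has_top (D (r + 1) c)) \<and>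
     (\<forall>r\<in>{1..k}. \<not> has_left (D r 1)) \<and>
     (\<forall>c\<in>{1..n}. \<not> has_top (D 1 c)) \<and>
     (\<forall>r\<in>{1..k}. has_right (D r n)) \<and>
     (\<forall>i j. 1 \<le> i \<longrightarrow> i < j \<longrightarrow> j \<le> k \<longrightarrow> card (crossings n k D i j) \<le> 1)"

definition assoc_perm :: "nat \<Rightarrow> nat \<Rightarrow> filling \<Rightarrow> nat \<Rightarrow> nat" where
  "assoc_perm n k D = (THE u. u \<in> Sdec n k \<and> (\<forall>i\<in>{1..k}. u i = pipe_exit n k D i))"

definition BPD :: "nat \<Rightarrow> (nat \<Rightarrow> nat) \<Rightarrow> filling set" where
  "BPD n w = {D. kBPD n n D \<and> assoc_perm n n D = w}"

definition first_rows :: "nat \<Rightarrow> filling \<Rightarrow> filling" where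
  "first_rows k D = (\<lambda>r c. if r \<le> k then D r c else Blank)"

definition chainBPD :: "nat \<Rightarrow> filling \<Rightarrow> (nat \<Rightarrow> nat) list" where
  "chainBPD n D = map (\<lambda>k. assoc_perm n k (first_rows k D)) (rev [0..<n])"

definition bpd_wt :: "nat \<Rightarrow> filling \<Rightarrow> int list" where
  "bpd_wt n D = map (\<lambda>i. int (card {c \<in> {1..n}. D i c = Blank})) [1..<n]"

end

theory Submission
  imports Defs
begin

text \<open>Let \<open>u\<^sub>k\<close> be the permutation of the first \<open>k\<close> rows. Adding row \<open>k\<close> to a \<open>(k-1)\<close>-row BPD means letting
  some pipes slide to the left along disjoint segments, pipe \<open>k\<close> coming in from a virtual column \<open>n+1\<close>.
  A row is determined by where pipes enter it from above and leave it below, so the BPD is recovered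
  from \<open>u\<^sub>0, \<dots>, u\<^sub>n\<close>. Two pipes cross in a row exactly when their left-to-right order is reversed there, so
  ``at most one crossing'' becomes a condition on each consecutive pair \<open>u\<^sub>k, u\<^sub>k\<^sub>-\<^sub>1\<close>, the relation \<open>pieri\<close>.

  The same relation characterises increasing \<open>k\<close>-chains from \<open>u\<^sub>k\<close> to \<open>u\<^sub>k\<^sub>-\<^sub>1\<close>. Given \<open>pieri\<close>, repeatedly
  raise the smallest value that still has to move to the next larger value sitting behind position \<open>k\<close>;
  this keeps the tail decreasing. The steps correspond to the non-blank cells of row \<open>k\<close> with no pipe
  entering from above, except for the largest such column, which gives the weights. Conversely, since
  the smaller exchanged values increase, a value that has been exchanged into the tail never moves
  again, and \<open>pieri\<close> follows by induction along the chain.\<close>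

section \<open>Bruhat covers\<close>

text \<open>Only the position pairs (i,j), (i,m) and (m,j) with i < m < j are reversed; all other
  pairs are permuted among themselves. Each m whose value lies strictly between the exchanged ones
  creates two inversions, the pair (i,j) creates one, and every other m contributes equally before
  and after.\<close>

lemma perm_len_transpose:
  assumes u: "u permutes {1..n}" and ij: "1 \<le> i" "i < j" "j \<le> n" and lt: "u i < u j"
  shows "perm_len n (u \<circ> transpose i j) =
    perm_len n u + 1 + 2 * card {m \<in> {i<..<j}. u i < u m \<and> u m < u j}"
proof -
  let ?t = "transpose i j"
  let ?v = "u \<circ> ?t"
  \<comment> \<open>Inversions whose positions keep their order under the transposition;
    \<open>lo\<close>, \<open>hi\<close> and \<open>top\<close> collect the remaining ones.\<close>
  define NF where "NF w = {(p, q). 1 \<le> p \<and> p < q \<and> q \<le> n \<and> w p > w q \<and> ?t p < ?t q}" for w :: "nat \<Rightarrow> nat"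
  define lo where "lo w = {m \<in> {i<..<j}. w i > w m}" for w :: "nat \<Rightarrow> nat"
  define hi where "hi w = {m \<in> {i<..<j}. w m > w j}" for w :: "nat \<Rightarrow> nat"
  define top where "top w = (if w i > w j then {(i, j)} else {})" for w :: "nat \<Rightarrow> nat"
  have fin: "finite (NF w)" for w
    by (rule finite_subset[of _ "{1..n} \<times> {1..n}"]) (auto simp: NF_def)
  have split: "{(p, q). 1 \<le> p \<and> p < q \<and> q \<le> n \<and> w p > w q} =
      NF w \<union> (top w \<union> (Pair i ` lo w \<union> (\<lambda>m. (m, j)) ` hi w))" for w
    using ij by (auto simp: NF_def lo_def hi_def top_def transpose_def image_iff split: if_splits)
  have len: "perm_len n w = card (NF w) + (card (top w) + (card (lo w) + card (hi w)))" for w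
  proof -
    have "card (Pair i ` lo w \<union> (\<lambda>m. (m, j)) ` hi w) = card (lo w) + card (hi w)"
      by (subst card_Un_disjoint)
         (auto simp: lo_def hi_def card_image inj_on_def)
    moreover have "card (top w \<union> (Pair i ` lo w \<union> (\<lambda>m. (m, j)) ` hi w)) =
        card (top w) + card (Pair i ` lo w \<union> (\<lambda>m. (m, j)) ` hi w)"
      by (rule card_Un_disjoint) (auto simp: top_def lo_def hi_def)
    moreover have "perm_len n w = card (NF w) + card (top w \<union> (Pair i ` lo w \<union> (\<lambda>m. (m, j)) ` hi w))"
      unfolding perm_len_def split
      by (rule card_Un_disjoint[OF fin])
         (use ij in \<open>auto simp: top_def lo_def hi_def NF_def transpose_def\<close>)
    ultimately show ?thesis by simp
  qed
  have tn: "1 \<le> p \<Longrightarrow> p \<le> n \<Longrightarrow> 1 \<le> ?t p \<and> ?t p \<le> n" for p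
    using ij by (auto simp: transpose_def)
  have "NF ?v = map_prod ?t ?t ` NF u"
  proof (intro set_eqI iffI)
    fix x assume "x \<in> NF ?v"
    then obtain p q where x: "x = (p, q)" "1 \<le> p" "p < q" "q \<le> n" "u (?t p) > u (?t q)" "?t p < ?t q"
      by (auto simp: NF_def)
    then have "(?t p, ?t q) \<in> NF u" using tn[of p] tn[of q] by (auto simp: NF_def)
    then show "x \<in> map_prod ?t ?t ` NF u" by (rule rev_image_eqI) (simp add: x)
  next
    fix x assume "x \<in> map_prod ?t ?t ` NF u"
    then obtain p q where x: "x = (?t p, ?t q)" "1 \<le> p" "p < q" "q \<le> n" "u p > u q" "?t p < ?t q"
      by (auto simp: NF_def)
    then show "x \<in> NF ?v" using tn[of p] tn[of q] by (auto simp: NF_def)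
  qed
  then have NFc: "card (NF ?v) = card (NF u)"
    by (simp add: card_image inj_on_subset[OF prod.inj_map[OF inj_transpose inj_transpose] subset_UNIV])
  let ?B = "{m \<in> {i<..<j}. u i < u m \<and> u m < u j}"
  have inj: "u a = u b \<longleftrightarrow> a = b" for a b using permutes_inj[OF u] by (auto dest: injD)
  have "lo ?v = lo u \<union> ?B"
    using lt inj by (auto simp: lo_def transpose_def order_less_le)
  moreover have "card (lo u \<union> ?B) = card (lo u) + card ?B"
    by (rule card_Un_disjoint) (auto simp: lo_def)
  ultimately have c1: "card (lo ?v) = card (lo u) + card ?B"
    by metis
  have "hi ?v = hi u \<union> ?B"
    using lt inj by (auto simp: hi_def transpose_def order_less_le)
  moreover have "card (hi u \<union> ?B) = card (hi u) + card ?B"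
    by (rule card_Un_disjoint) (auto simp: hi_def)
  ultimately have c2: "card (hi ?v) = card (hi u) + card ?B"
    by metis
  show ?thesis using lt by (simp add: len NFc c1 c2) (simp add: top_def)
qed

text \<open>The standard local criterion for a transposition to give a Bruhat cover.\<close>

definition bruhat_gap :: "(nat \<Rightarrow> nat) \<Rightarrow> nat \<Rightarrow> nat \<Rightarrow> bool" where
  "bruhat_gap u i j \<longleftrightarrow> u i < u j \<and> (\<forall>m. i < m \<longrightarrow> m < j \<longrightarrow> \<not> (u i < u m \<and> u m < u j))"

lemma perm_len_transpose_Suc_iff:
  assumes u: "u permutes {1..n}" and ij: "1 \<le> i" "i < j" "j \<le> n"
  shows "perm_len n (u \<circ> transpose i j) = perm_len n u + 1 \<longleftrightarrow> bruhat_gap u i j"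
proof (cases "u i < u j")
  case True
  then show ?thesis using perm_len_transpose[OF u ij True]
    by (auto simp: bruhat_gap_def)
next
  case False
  have neq: "u i \<noteq> u j" using permutes_inj[OF u] ij by (auto dest: injD)
  let ?v = "u \<circ> transpose i j"
  have v: "?v permutes {1..n}"
    using u ij by (intro permutes_compose permutes_swap_id) auto
  have uv: "u = ?v \<circ> transpose i j" by (auto simp: fun_eq_iff)
  \<comment> \<open>Here the length formula applies in the opposite direction and shows that the
    length drops.\<close>
  have "?v i < ?v j" using False neq by simp
  from perm_len_transpose[OF v ij this] have "perm_len n u > perm_len n ?v"
    unfolding uv[symmetric] by linarith
  then show ?thesis using False by (auto simp: bruhat_gap_def)
qed

section \<open>Increasing chains\<close>

text \<open>The parameter \<open>x\<close> bounds the smaller exchanged values from below.\<close>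
inductive inc_chain :: "nat \<Rightarrow> nat \<Rightarrow> nat \<Rightarrow> (nat \<Rightarrow> nat) \<Rightarrow> (nat \<Rightarrow> nat) \<Rightarrow> bool" for n k where
  refl: "v permutes {1..n} \<Longrightarrow> inc_chain n k x v v"
| step: "u permutes {1..n} \<Longrightarrow> 1 \<le> i \<Longrightarrow> i \<le> k \<Longrightarrow> k < j \<Longrightarrow> j \<le> n \<Longrightarrow> bruhat_gap u i j \<Longrightarrow> x \<le> u i \<Longrightarrow>
     inc_chain n k (Suc (u i)) (u \<circ> transpose i j) v \<Longrightarrow> inc_chain n k x u v"

text \<open>The witnesses of \<open>inc_kchain\<close> are made explicit so that a recursion over
  the list can peel off a permutation together with its transposition.\<close>

definition kchain_data :: "nat \<Rightarrow> nat \<Rightarrow> (nat \<Rightarrow> nat) list \<Rightarrow> nat list \<Rightarrow> nat list \<Rightarrow> bool" where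
  "kchain_data n k vs is js \<longleftrightarrow> vs \<noteq> [] \<and> (\<forall>v\<in>set vs. v permutes {1..n}) \<and>
     length is = length vs - 1 \<and> length js = length vs - 1 \<and>
        (\<forall>s < length vs - 1. 1 \<le> is!s \<and> is!s \<le> k \<and> k < js!s \<and> js!s \<le> n \<and>
            vs!(s+1) = vs!s \<circ> Transposition.transpose (is!s) (js!s) \<and>
            perm_len n (vs!(s+1)) = perm_len n (vs!s) + 1) \<and>
        (\<forall>s < length vs - 2.
            min ((vs!s) (is!s)) ((vs!s) (js!s)) < min ((vs!(s+1)) (is!(s+1))) ((vs!(s+1)) (js!(s+1))))"

lemma inc_kchain_iff_data: "inc_kchain n k vs \<longleftrightarrow> (\<exists>is js. kchain_data n k vs is js)"
proof -
  have "s + 1 < length vs - 1 \<longleftrightarrow> s < length vs - 2" for s by linarith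
  then show ?thesis by (simp add: inc_kchain_def kchain_data_def)
qed

lemma kchain_data_single: "kchain_data n k [u] is js \<longleftrightarrow> u permutes {1..n} \<and> is = [] \<and> js = []"
  by (auto simp: kchain_data_def)

lemma kchain_data_Cons:
  "kchain_data n k (u # v # vs) (i # is) (j # js) \<longleftrightarrow>
     u permutes {1..n} \<and> 1 \<le> i \<and> i \<le> k \<and> k < j \<and> j \<le> n \<and> v = u \<circ> Transposition.transpose i j \<and>
     bruhat_gap u i j \<and> kchain_data n k (v # vs) is js \<and>
     (vs \<noteq> [] \<longrightarrow> u i < min (v (hd is)) (v (hd js)))" (is "?L \<longleftrightarrow> ?R")
proof -
  have gap: "perm_len n (u \<circ> transpose i j) = Suc (perm_len n u) \<longleftrightarrow> bruhat_gap u i j"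
    if "u permutes {1..n}" "1 \<le> i" "i \<le> k" "k < j" "j \<le> n"
    using perm_len_transpose_Suc_iff[of u n i j] that by simp
  have min: "min (u i) (u j) = u i" if "bruhat_gap u i j"
    using that by (simp add: bruhat_gap_def)
  show ?thesis
  proof (cases vs)
    case Nil
    then show ?thesis using gap by (auto simp: kchain_data_def)
  next
    case (Cons v' vs')
    show ?thesis
    proof (cases "length is = Suc (length vs') \<and> length js = Suc (length vs')")
      case True
      then obtain i' is' j' js' where [simp]: "is = i' # is'" "js = j' # js'"
        by (auto simp: length_Suc_conv)
      show ?thesis using gap min
        by (auto simp: kchain_data_def Cons All_less_Suc2)
    qed (auto simp: kchain_data_def Cons)
  qed
qed

lemma inc_chain_imp_inc_kchain:
  assumes "inc_chain n k x u v"
  shows "\<exists>vs. inc_kchain n k vs \<and> hd vs = u \<and> last vs = v"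
proof -
  \<comment> \<open>The bound on the first exchanged value is added to the claim; it yields the
    strict increase when a step is put in front.\<close>
  have "\<exists>vs is js. kchain_data n k (u # vs) is js \<and> last (u # vs) = v \<and>
      (vs \<noteq> [] \<longrightarrow> x \<le> min (u (hd is)) (u (hd js)))"
    using assms
  proof induction
    case (refl v x)
    then have "kchain_data n k [v] [] []" by (simp add: kchain_data_single)
    then show ?case by (intro exI[of _ "[]"]) simp
  next
    case (step u i j x v)
    then obtain vs "is" js where IH: "kchain_data n k ((u \<circ> transpose i j) # vs) is js"
        "last ((u \<circ> transpose i j) # vs) = v"
        "vs \<noteq> [] \<longrightarrow> Suc (u i) \<le> min ((u \<circ> transpose i j) (hd is)) ((u \<circ> transpose i j) (hd js))"
      by blast
    then have "kchain_data n k (u # (u \<circ> transpose i j) # vs) (i # is) (j # js)"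
      using step.hyps by (subst kchain_data_Cons) auto
    moreover have "x \<le> min (u i) (u j)" using step.hyps by (auto simp: bruhat_gap_def)
    ultimately show ?case using IH(2)
      by (intro exI[of _ "(u \<circ> transpose i j) # vs"] exI[of _ "i # is"] exI[of _ "j # js"]) simp
  qed
  then show ?thesis by (metis inc_kchain_iff_data list.sel(1))
qed

lemma kchain_data_imp_inc_chain:
  "kchain_data n k (u # vs) is js \<Longrightarrow> (vs \<noteq> [] \<longrightarrow> x \<le> min (u (hd is)) (u (hd js))) \<Longrightarrow>
   inc_chain n k x u (last (u # vs))"
proof (induction vs arbitrary: u "is" js x)
  case Nil
  then show ?case by (simp add: kchain_data_single inc_chain.refl)
next
  case (Cons v vs)
  then obtain i is' j js' where [simp]: "is = i # is'" "js = j # js'"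
    by (cases "is"; cases js) (auto simp: kchain_data_def)
  from Cons.prems(1) have *: "u permutes {1..n}" "1 \<le> i" "i \<le> k" "k < j" "j \<le> n"
    "v = u \<circ> Transposition.transpose i j" "bruhat_gap u i j" "kchain_data n k (v # vs) is' js'"
    "vs \<noteq> [] \<longrightarrow> Suc (u i) \<le> min (v (hd is')) (v (hd js'))"
    by (auto simp: kchain_data_Cons)
  have "x \<le> u i" using Cons.prems(2) by simp
  moreover have "inc_chain n k (Suc (u i)) (u \<circ> transpose i j) (last (v # vs))"
    using Cons.IH[OF *(8,9)] *(6) by metis
  ultimately have "inc_chain n k x u (last (v # vs))"
    using * by (intro inc_chain.step[of u n i k j x])
  then show ?case by simp
qed

lemma inc_chain_iff_inc_kchain:
  "inc_chain n k 0 u v \<longleftrightarrow> (\<exists>vs. inc_kchain n k vs \<and> hd vs = u \<and> last vs = v)"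
proof
  assume "\<exists>vs. inc_kchain n k vs \<and> hd vs = u \<and> last vs = v"
  then obtain vs "is" js where "kchain_data n k vs is js" "hd vs = u" "last vs = v"
    by (auto simp: inc_kchain_iff_data)
  moreover then have "vs = u # tl vs" by (cases vs) (auto simp: kchain_data_def)
  ultimately show "inc_chain n k 0 u v" by (metis kchain_data_imp_inc_chain le0)
qed (rule inc_chain_imp_inc_kchain)

section \<open>Permutations that decrease behind position k\<close>

lemma Sdec_permutes: "u \<in> Sdec n k \<Longrightarrow> u permutes {1..n}"
  by (simp add: Sdec_def)

lemma Sdec_less: "u \<in> Sdec n k \<Longrightarrow> k < i \<Longrightarrow> i < j \<Longrightarrow> j \<le> n \<Longrightarrow> u j < u i"
  by (simp add: Sdec_def)

lemma Sdec_mono: "u \<in> Sdec n k \<Longrightarrow> k \<le> k' \<Longrightarrow> u \<in> Sdec n k'"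
  by (simp add: Sdec_def)

lemma permutes_eq_iff: "u permutes S \<Longrightarrow> u a = u b \<longleftrightarrow> a = b"
  using permutes_inj by (auto dest: injD)

text \<open>The first position p of disagreement lies beyond k. The larger of the two values at p
  must occur somewhere in the other permutation: not after p, where that one decreases, and not
  before p, where both agree.\<close>

lemma Sdec_unique:
  assumes u: "u \<in> Sdec n k" and v: "v \<in> Sdec n k" and eq: "\<And>i. i \<in> {1..k} \<Longrightarrow> u i = v i"
  shows "u = v"
proof (rule ccontr)
  note pu = Sdec_permutes[OF u] and pv = Sdec_permutes[OF v]
  assume "u \<noteq> v"
  then obtain i where "u i \<noteq> v i" by auto
  then have ex: "\<exists>i. u i \<noteq> v i" by blast
  define p where "p = (LEAST i. u i \<noteq> v i)"
  have p: "u p \<noteq> v p" unfolding p_def using ex by (rule LeastI_ex)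
  have less: "u q = v q" if "q < p" for q using that not_less_Least p_def by blast
  have pn: "p \<in> {1..n}" using p permutes_not_in[OF pu] permutes_not_in[OF pv] by metis
  then have pk: "k < p" using p eq by force
  have main: "\<not> a p < b p" if a: "a \<in> Sdec n k" and b: "b \<in> Sdec n k"
    and less: "\<And>q. q < p \<Longrightarrow> a q = b q" for a b
  proof
    assume lt: "a p < b p"
    have "b p \<in> a ` {1..n}" using pn permutes_image[OF Sdec_permutes[OF a]] permutes_in_image[OF Sdec_permutes[OF b]]
      by metis
    then obtain q where q: "q \<in> {1..n}" "a q = b p" by auto
    have "q < p" using q lt Sdec_less[OF a pk, of q] by (metis atLeastAtMost_iff less_imp_not_less linorder_neqE_nat)
    then have "b q = b p" using less q by metis
    then show False using permutes_eq_iff[OF Sdec_permutes[OF b]] \<open>q < p\<close> by auto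
  qed
  show False using main[OF u v] main[OF v u] less p by (metis linorder_neqE_nat)
qed

text \<open>The values not taken by e are listed in decreasing order behind position k.\<close>

lemma ex_Sdec:
  assumes "inj_on e {1..k}" "e ` {1..k} \<subseteq> {1..n}" "k \<le> n"
  shows "\<exists>u \<in> Sdec n k. \<forall>i\<in>{1..k}. u i = e i"
proof -
  define C where "C = {1..n} - e ` {1..k}"
  define L where "L = rev (sorted_list_of_set C)"
  have cC: "card C = n - k"
    using assms by (simp add: C_def card_Diff_subset card_image)
  have L: "length L = n - k" "set L = C" "distinct L" "sorted_wrt (>) L"
    using cC by (auto simp: L_def C_def sorted_wrt_rev)
  define u where "u i = (if i \<in> {1..k} then e i else if i \<in> {k<..n} then L ! (i - k - 1) else i)" for i
  have inL: "u i \<in> C" if "i \<in> {k<..n}" for i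
    using that L nth_mem[of "i - k - 1" L] by (auto simp: u_def)
  have inE: "u i \<in> e ` {1..k}" if "i \<in> {1..k}" for i using that by (auto simp: u_def)
  have dec: "u j < u i" if "k < i" "i < j" "j \<le> n" for i j
    using that L sorted_wrt_nth_less[OF L(4), of "i - k - 1" "j - k - 1"] by (auto simp: u_def)
  have inj: "inj_on u {1..n}"
  proof (rule linorder_inj_onI')
    fix i j assume ij: "i \<in> {1..n}" "j \<in> {1..n}" "i < j"
    consider "k < i" | "j \<le> k" | "i \<le> k" "k < j" by linarith
    then show "u i \<noteq> u j"
    proof cases
      case 1 then show ?thesis using dec[of i j] ij by auto
    next
      case 2 then show ?thesis using ij inj_on_contraD[OF assms(1), of i j] by (simp add: u_def)
    next
      case 3 then show ?thesis using ij inE[of i] inL[of j] by (auto simp: C_def)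
    qed
  qed
  have "u ` {1..n} \<subseteq> {1..n}"
  proof safe
    fix i assume "i \<in> {1..n}"
    then show "u i \<in> {1..n}" using inE[of i] inL[of i] assms(2) by (cases "i \<le> k") (auto simp: C_def)
  qed
  then have "bij_betw u {1..n} {1..n}" using inj endo_inj_surj[of "{1..n}" u] by (simp add: bij_betw_def)
  then have "u permutes {1..n}"
    by (rule bij_imp_permutes) (use assms(3) in \<open>auto simp: u_def\<close>)
  then have "u \<in> Sdec n k" using dec by (auto simp: Sdec_def)
  then show ?thesis by (intro bexI[of _ u]) (auto simp: u_def)
qed

text \<open>For values \<open>u i\<close> sliding leftwards from \<open>v i\<close> along a row, \<open>flow\<close> says that the horizontal
  segments are disjoint and are crossed only by pipes going straight down. The extra condition in
  \<open>pieri\<close> is the same for rows and for chains: in a row it forbids a second crossing of two pipes, in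
  a chain it makes every step a Bruhat cover.\<close>

definition flow :: "nat \<Rightarrow> (nat \<Rightarrow> nat) \<Rightarrow> (nat \<Rightarrow> nat) \<Rightarrow> bool" where
  "flow k u a \<longleftrightarrow>
     (\<forall>i\<in>{1..k}. u i \<le> a i) \<and>
     (\<forall>i\<in>{1..k}. \<forall>m\<in>{1..k}. u i < a i \<longrightarrow> u i \<noteq> a m) \<and>
     (\<forall>i\<in>{1..k}. \<forall>m\<in>{1..k}. u i < a m \<longrightarrow> a m < a i \<longrightarrow> u m = a m)"

lemma flow_le: "flow k u a \<Longrightarrow> i \<in> {1..k} \<Longrightarrow> u i \<le> a i"
  unfolding flow_def by blast

lemma flow_source: "flow k u a \<Longrightarrow> i \<in> {1..k} \<Longrightarrow> m \<in> {1..k} \<Longrightarrow> u i < a i \<Longrightarrow> u i \<noteq> a m"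
  unfolding flow_def by blast

lemma flow_between:
  "flow k u a \<Longrightarrow> i \<in> {1..k} \<Longrightarrow> m \<in> {1..k} \<Longrightarrow> u i < a m \<Longrightarrow> a m < a i \<Longrightarrow> u m = a m"
  unfolding flow_def by blast

text \<open>An exit that equals an entry column belongs to a pipe that did not move, so p would be i
  itself, which does move.\<close>

lemma flow_target:
  assumes F: "flow k u a" and a: "inj_on a {1..k}" and ip: "i \<in> {1..k}" "p \<in> {1..k}" "u i < a i"
  shows "u p \<noteq> a i"
proof
  assume eq: "u p = a i"
  then have "u p = a p" using flow_le[OF F ip(2)] flow_source[OF F ip(2,1)] by linarith
  then have "p = i" using eq inj_on_eq_iff[OF a ip(2,1)] by simp
  then show False using eq ip(3) by simp
qed

definition pieri :: "nat \<Rightarrow> (nat \<Rightarrow> nat) \<Rightarrow> (nat \<Rightarrow> nat) \<Rightarrow> bool" where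
  "pieri k u v \<longleftrightarrow> flow k u v \<and>
     (\<forall>i\<in>{1..k}. \<forall>m\<in>{1..k}. u i < v m \<longrightarrow> v m < v i \<longrightarrow> m < i)"

lemma pieri_le: "pieri k u v \<Longrightarrow> i \<in> {1..k} \<Longrightarrow> u i \<le> v i"
  unfolding pieri_def flow_def by blast

lemma pieri_source: "pieri k u v \<Longrightarrow> i \<in> {1..k} \<Longrightarrow> m \<in> {1..k} \<Longrightarrow> u i < v i \<Longrightarrow> u i \<noteq> v m"
  unfolding pieri_def flow_def by blast

lemma pieri_between:
  "pieri k u v \<Longrightarrow> i \<in> {1..k} \<Longrightarrow> m \<in> {1..k} \<Longrightarrow> u i < v m \<Longrightarrow> v m < v i \<Longrightarrow> u m = v m \<and> m < i"
  unfolding pieri_def flow_def by blast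

lemma pieriI:
  assumes "\<And>i. i \<in> {1..k} \<Longrightarrow> u i \<le> v i"
    and "\<And>i m. i \<in> {1..k} \<Longrightarrow> m \<in> {1..k} \<Longrightarrow> u i < v i \<Longrightarrow> u i = v m \<Longrightarrow> False"
    and "\<And>i m. i \<in> {1..k} \<Longrightarrow> m \<in> {1..k} \<Longrightarrow> u i < v m \<Longrightarrow> v m < v i \<Longrightarrow> u m = v m \<and> m < i"
  shows "pieri k u v"
  unfolding pieri_def flow_def using assms by blast

lemma pieri_target:
  assumes "pieri k u v" "inj_on v {1..k}" "i \<in> {1..k}" "p \<in> {1..k}" "u i < v i"
  shows "u p \<noteq> v i"
  using assms flow_target unfolding pieri_def by blast

section \<open>Equivalence of \<open>pieri\<close> and increasing chains\<close>

lemma Sdec_transpose: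
  assumes u: "u \<in> Sdec n k" and ij: "1 \<le> i" "i \<le> k" "k < j" "j \<le> n"
    and bef: "\<And>p. k < p \<Longrightarrow> p < j \<Longrightarrow> u i < u p" and aft: "\<And>p. j < p \<Longrightarrow> p \<le> n \<Longrightarrow> u p < u i"
  shows "u \<circ> transpose i j \<in> Sdec n k"
proof -
  have "u \<circ> transpose i j permutes {1..n}"
    using Sdec_permutes[OF u] ij by (intro permutes_compose permutes_swap_id) auto
  then show ?thesis using Sdec_less[OF u] ij bef aft
    by (auto simp: Sdec_def transpose_def)
qed

text \<open>Induction on the total distance still to travel. The counted set consists of the tail
  values of v that lie on the way of some value still moving; each step removes exactly one of them,
  the smaller exchanged value.\<close>

lemma pieri_imp_inc_chain:
  assumes "u \<in> Sdec n k" "v \<in> Sdec n k" "pieri k u v" "k \<le> n"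
    "\<And>i. i \<in> {1..k} \<Longrightarrow> u i < v i \<Longrightarrow> x \<le> u i"
  shows "inc_chain n k x u v \<and>
    perm_len n v = perm_len n u + card {c \<in> v ` {k<..n}. \<exists>i\<in>{1..k}. u i \<le> c \<and> c < v i}"
  using assms(1,3,5)
proof (induction "\<Sum>i\<in>{1..k}. v i - u i" arbitrary: u x rule: less_induct)
  case (less u x)
  note u = less.prems(1) and P = less.prems(2) and x = less.prems(3) and v = assms(2)
  note pu = Sdec_permutes[OF u] and pv = Sdec_permutes[OF v]
  have iv: "inj_on v {1..k}" by (rule inj_on_subset[OF permutes_inj[OF pv]]) simp
  show ?case
  proof (cases "\<exists>i\<in>{1..k}. u i < v i")
    case False
    then have "u i = v i" if "i \<in> {1..k}" for i using pieri_le[OF P that] that by force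
    then have "u = v" by (rule Sdec_unique[OF u v])
    moreover have "{c \<in> v ` {k<..n}. \<exists>i\<in>{1..k}. v i \<le> c \<and> c < v i} = {}" by auto
    ultimately show ?thesis using inc_chain.refl[OF pv] by simp
  next
    case True
    \<comment> \<open>The smallest value that must still move; its minimality makes the exchanged
      values increase.\<close>
    then obtain i where i: "i \<in> {1..k}" "u i < v i"
      and imin: "\<And>p. p \<in> {1..k} \<Longrightarrow> u p < v p \<Longrightarrow> u i \<le> u p"
      using ex_has_least_nat[of "\<lambda>i. i \<in> {1..k} \<and> u i < v i" _ u] by blast
    have "v i \<in> u ` {1..n}"
      using permutes_image[OF pu] permutes_in_image[OF pv, of i] i assms(4) by auto
    then obtain q where q: "q \<in> {1..n}" "v i = u q" by auto
    \<comment> \<open>The destination of i is held by the tail of u, so the tail contains a value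
      above u i and j can be chosen.\<close>
    have qk: "k < q" using q pieri_target[OF P iv i(1) _ i(2), of q] by force
    obtain j where j: "k < j" "j \<le> n" "u i < u j"
      and jmin: "\<And>p. k < p \<Longrightarrow> p \<le> n \<Longrightarrow> u i < u p \<Longrightarrow> u j \<le> u p"
      using ex_has_least_nat[of "\<lambda>j. k < j \<and> j \<le> n \<and> u i < u j" q u] q qk i by auto
    have jv: "u j \<le> v i" using jmin[OF qk] q i by simp
    have ij: "1 \<le> i" "i \<le> k" using i by auto
    have jk: "u j \<noteq> u p" if "p \<in> {1..k}" for p using permutes_eq_iff[OF pu] that j by auto
    \<comment> \<open>By the choice of j, every value from u i up to just below u j sits in the
      first k positions.\<close>
    have lowpos: "p \<in> {1..k}" if "u i \<le> u p" "u p < u j" "p \<in> {1..n}" for p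
    proof (rule ccontr)
      assume "p \<notin> {1..k}"
      then have kp: "k < p" "p \<le> n" using that by auto
      then have "u i \<noteq> u p" using permutes_eq_iff[OF pu, of i p] ij by auto
      then show False using jmin[OF kp] that by simp
    qed
    \<comment> \<open>The destination of such a p would lie either below or above v i; in each case
      the betweenness condition freezes one of two positions that both move.\<close>
    have other: "\<not> (u i < u p \<and> u p < u j \<and> u p < v p)" if p: "p \<in> {1..k}" for p
    proof
      assume *: "u i < u p \<and> u p < u j \<and> u p < v p"
      then have "p \<noteq> i" by auto
      then have "v p \<noteq> v i" using permutes_eq_iff[OF pv] by auto
      then consider "v p < v i" | "v i < v p" by linarith
      then show False
        using pieri_between[OF P i(1) p] pieri_between[OF P p i(1)] i * jv by cases auto
    qed
    \<comment> \<open>An obstruction m would be a frozen position to the right of i among the first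
      k, whereas \<open>pieri\<close> demands m < i.\<close>
    have gap: "bruhat_gap u i j"
    proof -
      have False if m: "i < m" "m < j" "u i < u m" "u m < u j" for m
      proof -
        have mk: "m \<in> {1..k}" using lowpos[of m] m j by auto
        then have "u m = v m" using other[OF mk] m pieri_le[OF P mk] by linarith
        then have "m < i" using pieri_between[OF P i(1) mk] m jv by simp
        then show False using m by simp
      qed
      then show ?thesis using j by (auto simp: bruhat_gap_def)
    qed
    define u' where "u' = u \<circ> transpose i j"
    have u'i: "u' i = u j" and u'p: "\<And>p. p \<in> {1..k} \<Longrightarrow> p \<noteq> i \<Longrightarrow> u' p = u p"
      using j by (auto simp: u'_def transpose_def)
    \<comment> \<open>No tail value lies between u i and u j, so u i fits into the place of u
      j.\<close>
    have S': "u' \<in> Sdec n k"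
      unfolding u'_def
    proof (rule Sdec_transpose[OF u ij j(1,2)])
      fix p assume "k < p" "p < j"
      then show "u i < u p" using Sdec_less[OF u, of p j] j by simp
    next
      fix p assume p: "j < p" "p \<le> n"
      then have "u p < u j" using Sdec_less[OF u, of j p] j by simp
      moreover have "u p \<noteq> u i" using permutes_eq_iff[OF pu] p ij j by auto
      ultimately show "u p < u i" using jmin[of p] p j by force
    qed
    have P': "pieri k u' v"
    proof (rule pieriI)
      fix p assume "p \<in> {1..k}"
      then show "u' p \<le> v p" using pieri_le[OF P] u'i u'p jv by (cases "p = i") auto
    next
      fix p m assume *: "p \<in> {1..k}" "m \<in> {1..k}" "u' p < v p" "u' p = v m"
      show False
      proof (cases "p = i")
        case True
        then show False using * u'i pieri_between[OF P i(1) *(2)] j jk[OF *(2)] by auto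
      next
        case False
        then show False using * u'p pieri_source[OF P *(1,2)] by auto
      qed
    next
      fix p m assume *: "p \<in> {1..k}" "m \<in> {1..k}" "u' p < v m" "v m < v p"
      have "u p \<le> u' p" using *(1) u'i u'p j by (cases "p = i") auto
      then have "u m = v m \<and> m < p" using pieri_between[OF P *(1,2)] * by simp
      moreover then have "m \<noteq> i" using i by auto
      ultimately show "u' m = v m \<and> m < p" using u'p[OF *(2)] by simp
    qed
    let ?T = "\<lambda>u. {c \<in> v ` {k<..n}. \<exists>i\<in>{1..k}. u i \<le> c \<and> c < v i}"
    \<comment> \<open>Everything still moving now lies above u i, which justifies the bound
      \<open>Suc (u i)\<close> for the rest of the chain.\<close>
    have above: "Suc (u i) \<le> u' p" if "p \<in> {1..k}" "u' p < v p" for p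
    proof (cases "p = i")
      case True then show ?thesis using u'i j by simp
    next
      case False
      then have "u i \<noteq> u p" using permutes_eq_iff[OF pu] by auto
      then show ?thesis using imin[OF that(1)] u'p that False by force
    qed
    have dec: "(\<Sum>p\<in>{1..k}. v p - u' p) < (\<Sum>p\<in>{1..k}. v p - u p)"
    proof (rule sum_strict_mono_ex1)
      show "\<forall>p\<in>{1..k}. v p - u' p \<le> v p - u p"
        using u'i u'p j by (metis diff_le_mono2 less_imp_le order_refl)
      show "\<exists>p\<in>{1..k}. v p - u' p < v p - u p"
        using i u'i j by (intro bexI[of _ i]) auto
    qed simp
    have T: "?T u = insert (u i) (?T u')" "u i \<notin> ?T u'"
    proof -
      show "u i \<notin> ?T u'" using above by fastforce
      have "u i \<in> v ` {1..n}"
        using permutes_image[OF pv] permutes_in_image[OF pu, of i] i assms(4) by auto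
      then obtain r where r: "r \<in> {1..n}" "u i = v r" by auto
      \<comment> \<open>A moving position starts from a value that v has at none of the first k
        positions, so u i is a tail value of v.\<close>
      then have "r \<in> {k<..n}" using pieri_source[OF P i(1) _ i(2), of r] by force
      then have "u i \<in> ?T u" using r i by (auto intro!: bexI[of _ i])
      moreover have "?T u' \<subseteq> ?T u"
      proof -
        have "u p \<le> u' p" if "p \<in> {1..k}" for p using u'i u'p j that by (cases "p = i") auto
        then show ?thesis by (blast intro: order_trans)
      qed
      moreover have "c \<in> ?T u'" if c: "c \<in> ?T u" "c \<noteq> u i" for c
      proof -
        from c obtain p where p: "p \<in> {1..k}" "u p \<le> c" "c < v p" by auto
        from c obtain s where s: "s \<in> {k<..n}" "c = v s" by auto
        show ?thesis
        proof (cases "p = i \<and> c < u j")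
          case False
          then have "u' p \<le> c" using p u'i u'p by (cases "p = i") auto
          then show ?thesis using c p by auto
        next
          case True
          \<comment> \<open>Here c lies on the stretch from u i to u j that i has just skipped. Then
            c is the value of u at some position r up to k; as c belongs to the tail of v, position
            r has to move as well and keeps c in the set.\<close>
          have "c \<in> u ` {1..n}"
            using permutes_image[OF pu] permutes_in_image[OF pv, of s] s by auto
          then obtain r where r: "r \<in> {1..n}" "c = u r" by auto
          have rk: "r \<in> {1..k}" using lowpos[of r] r True p by auto
          have "r \<noteq> i" using r c by auto
          have "v r \<noteq> c" using s rk permutes_eq_iff[OF pv, of r s] by auto
          then have "u r < v r" using pieri_le[OF P rk] r by simp
          then show ?thesis using c rk r u'p[OF rk \<open>r \<noteq> i\<close>]
            by (auto intro!: bexI[of _ r])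
        qed
      qed
      ultimately show "?T u = insert (u i) (?T u')" by blast
    qed
    have "finite (?T u')" by simp
    then have card: "card (?T u) = Suc (card (?T u'))" using T by simp
    from less.hyps[OF dec S' P' above]
    have IH: "inc_chain n k (Suc (u i)) u' v" "perm_len n v = perm_len n u' + card (?T u')" by auto
    have "perm_len n u' = perm_len n u + 1"
      unfolding u'_def using perm_len_transpose_Suc_iff[OF pu ij(1) _ j(2)] ij j gap by simp
    moreover have "inc_chain n k x u v"
      using IH(1) inc_chain.step[OF pu ij j(1,2) gap x[OF i]] by (simp add: u'_def)
    ultimately show ?thesis using IH(2) card by simp
  qed
qed

text \<open>Induction from the end of the chain to its beginning. The third conjunct is carried
  along because all later steps exchange values of at least x, so smaller entries are final.\<close>

lemma inc_chain_imp_pieri: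
  assumes "inc_chain n k x u v" "v \<in> Sdec n k"
  shows "u \<in> Sdec n k \<and> pieri k u v \<and> (\<forall>p. u p < x \<longrightarrow> v p = u p)"
  using assms
proof induction
  case (refl v x)
  then show ?case by (auto intro: pieriI)
next
  case (step u i j x v)
  note v = step.prems and pu = step.hyps(1) and ij = step.hyps(2-5)
  define u' where "u' = u \<circ> transpose i j"
  from step have S': "u' \<in> Sdec n k" and P: "pieri k u' v" and fixed: "\<And>p. u' p \<le> u i \<Longrightarrow> v p = u' p"
    unfolding u'_def by (blast, blast, simp add: less_Suc_eq_le)
  note pu' = Sdec_permutes[OF S'] and pv = Sdec_permutes[OF v]
  have iv: "inj_on v {1..k}" by (rule inj_on_subset[OF permutes_inj[OF pv]]) simp
  have ik: "i \<in> {1..k}" using ij by auto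
  have u'i: "u' i = u j" and u'j: "u' j = u i" and u'p: "\<And>p. p \<noteq> i \<Longrightarrow> p \<noteq> j \<Longrightarrow> u' p = u p"
    by (auto simp: u'_def transpose_def)
  have pk: "p \<noteq> j" if "p \<in> {1..k}" for p using that ij by auto
  have lt: "u i < u j" and gap: "\<And>m. i < m \<Longrightarrow> m < j \<Longrightarrow> u i < u m \<Longrightarrow> u m < u j \<Longrightarrow> False"
    using step.hyps(6) by (auto simp: bruhat_gap_def)
  \<comment> \<open>The value just exchanged into the tail lies below the new bound, hence is
    final.\<close>
  have vj: "v j = u i" using fixed[of j] u'j by simp
  have jv: "u j \<le> v i" using pieri_le[OF P ik] u'i by simp
  have moved: "u i < u' p" if "p \<in> {1..k}" "u' p < v p" for p
    using fixed[of p] that by force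
  have uu: "u = u' \<circ> transpose i j" by (auto simp: u'_def fun_eq_iff)
  have "u \<in> Sdec n k"
    unfolding uu
  proof (rule Sdec_transpose[OF S' ij])
    \<comment> \<open>Such a tail entry exceeds u i because the tail of u' decreases, and the cover
      condition then pushes it above u j.\<close>
    fix p assume p: "k < p" "p < j"
    then have "u i < u' p" using Sdec_less[OF S', of p j] ij u'j by simp
    then have "u i < u p" "p \<noteq> i" using u'p[of p] p ij by auto
    then have "\<not> u p < u j" using gap[of p] p ij by auto
    moreover have "u p \<noteq> u j" using permutes_eq_iff[OF pu] p by auto
    ultimately show "u' i < u' p" using u'i u'p[of p] p \<open>p \<noteq> i\<close> by simp
  next
    fix p assume "j < p" "p \<le> n"
    then show "u' p < u' i" using Sdec_less[OF S', of j p] ij u'j u'i lt by simp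
  qed
  moreover have "pieri k u v"
  proof (rule pieriI)
    fix p assume p: "p \<in> {1..k}"
    then show "u p \<le> v p" using pieri_le[OF P p] jv lt u'p pk[OF p] by (cases "p = i") auto
  next
    fix p m assume *: "p \<in> {1..k}" "m \<in> {1..k}" "u p < v p" "u p = v m"
    show False
    proof (cases "p = i")
      case True
      then have "v j = v m" using vj * by simp
      then show False using permutes_eq_iff[OF pv, of j m] pk[OF *(2)] by simp
    next
      case False
      then show False using * u'p pk pieri_source[OF P *(1,2)] by auto
    qed
  next
    fix p m assume *: "p \<in> {1..k}" "m \<in> {1..k}" "u p < v m" "v m < v p"
    then have "m \<noteq> p" by auto
    consider (a) "p \<noteq> i" "m \<noteq> i" | (b) "p \<noteq> i" "m = i" | (c) "p = i" "m \<noteq> i"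
      using \<open>m \<noteq> p\<close> by blast
    then show "u m = v m \<and> m < p"
    proof cases
      case a
      then show ?thesis using pieri_between[OF P *(1,2)] * u'p pk by auto
    next
      case b
      \<comment> \<open>Here i would already be final with value u j, and the moving position p
        would obstruct the cover, both in position and in value.\<close>
      have e: "u' p = u p" using u'p b pk[OF *(1)] by simp
      then have "u' i = v i" "i < p" using pieri_between[OF P *(1,2)] * b by auto
      moreover have "u i < u p" using moved[OF *(1)] e * by simp
      ultimately have False using gap[of p] * b u'i ij by auto
      then show ?thesis ..
    next
      case c
      have e: "u' m = u m" using u'p c pk[OF *(2)] by simp
      consider "u j < v m" | "v m = u j" | "v m < u j" by linarith
      then show ?thesis
      proof cases
        case 1
        then show ?thesis using pieri_between[OF P ik *(2)] * c u'i e by auto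
      next
        case 2
        then have "u' i = v m" "u' i < v i" using u'i * c by auto
        then show ?thesis using pieri_source[OF P ik *(2)] by auto
      next
        case 3
        \<comment> \<open>Otherwise the target v m would still be held in the tail, at a position
          before j, and would obstruct the cover.\<close>
        have um: "u m = v m"
        proof (rule ccontr)
          assume "u m \<noteq> v m"
          then have mv: "u' m < v m" using pieri_le[OF P *(2)] e by simp
          have "m \<le> n" using *(2) ij by simp
          then have "v m \<in> u' ` {1..n}"
            using permutes_image[OF pu'] permutes_in_image[OF pv, of m] *(2) by auto
          then obtain q where q: "q \<in> {1..n}" "v m = u' q" by auto
          have qk: "k < q" using q pieri_target[OF P iv *(2) _ mv, of q] by force
          have "u i < v m" using moved[OF *(2) mv] mv by simp
          then have "q < j" using Sdec_less[OF S' ij(3), of q] q u'j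
            by (metis atLeastAtMost_iff less_imp_not_less less_irrefl linorder_neqE_nat)
          moreover have "u q = v m" using u'p[of q] qk ij q \<open>q < j\<close> by auto
          ultimately show False using gap[of q] qk ij 3 \<open>u i < v m\<close> by auto
        qed
        then have "\<not> i < m" using gap[of m] 3 * c ij by auto
        then show ?thesis using um c by auto
      qed
    qed
  qed
  moreover have "v p = u p" if "u p < x" for p
  proof -
    have "u p < u i" using that step.hyps(7) by simp
    then have "p \<noteq> i" "p \<noteq> j" using lt by auto
    then show ?thesis using fixed[of p] u'p \<open>u p < u i\<close> by auto
  qed
  ultimately show ?case by blast
qed

section \<open>Replacing the last entry by the virtual column n+1\<close>

lemma Sdec_max_rest:
  assumes "v \<in> Sdec n (k - 1)" "1 \<le> k" "c \<in> {1..n}" "\<And>i. i \<in> {1..<k} \<Longrightarrow> c \<noteq> v i"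
  shows "c \<le> v k"
proof -
  have "c \<in> v ` {1..n}" using assms(3) permutes_image[OF Sdec_permutes[OF assms(1)]] by simp
  then obtain q where q: "q \<in> {1..n}" "c = v q" by auto
  then have "k \<le> q" using assms(4)[of q] by force
  then show ?thesis using Sdec_less[OF assms(1), of k q] q assms(2) by (cases "k = q") auto
qed

text \<open>In the chain, k starts from the value v k; in the row, pipe k starts from the virtual
  column. As v k is the largest value outside the first k-1 entries, only columns of earlier pipes
  lie in between, and either version forces these pipes to go straight down.\<close>

lemma pieri_entry_iff:
  assumes v: "v \<in> Sdec n (k - 1)" and u: "u permutes {1..n}" and k: "1 \<le> k" "k \<le> n"
  shows "pieri k u v \<longleftrightarrow> pieri k u (v(k := Suc n))"
proof
  have un: "u i \<in> {1..n}" if "i \<in> {1..k}" for i using permutes_in_image[OF u, of i] that k by auto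
  note pv = Sdec_permutes[OF v]
  have vn: "v i \<in> {1..n}" if "i \<in> {1..k}" for i using permutes_in_image[OF pv, of i] that k by auto
  have kk: "k \<in> {1..k}" using k by simp
  {
    assume P: "pieri k u v"
    \<comment> \<open>A pipe m moving from beyond v k would have to land below v k; running over v
      k, it would violate the order condition of \<open>pieri\<close>.\<close>
    have d: "u m = v m" if m: "m \<in> {1..<k}" "v k < v m" for m
    proof (rule ccontr)
      have mk: "m \<in> {1..k}" using m by auto
      assume "u m \<noteq> v m"
      then have lt: "u m < v m" using pieri_le[OF P mk] by simp
      then have "u m \<le> v k"
        using Sdec_max_rest[OF v k(1), of "u m"] un[OF mk] pieri_source[OF P mk] by force
      moreover have "u m \<noteq> v k" using pieri_source[OF P mk kk lt] .
      ultimately show False using pieri_between[OF P mk kk] m by auto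
    qed
    show "pieri k u (v(k := Suc n))"
    proof (rule pieriI)
      fix i assume "i \<in> {1..k}"
      then show "u i \<le> (v(k := Suc n)) i" using pieri_le[OF P] un[of i] by auto
    next
      fix i m assume *: "i \<in> {1..k}" "m \<in> {1..k}" "u i < (v(k := Suc n)) i" "u i = (v(k := Suc n)) m"
      have "m \<noteq> k" using * un[of i] by auto
      then have eq: "u i = v m" using * by simp
      then have "\<not> u i < v i" using pieri_source[OF P *(1,2)] by auto
      then have "u i = v i" using pieri_le[OF P *(1)] by simp
      then have "i = m" using eq permutes_eq_iff[OF pv] by simp
      then show False using * \<open>m \<noteq> k\<close> by auto
    next
      fix i m assume *: "i \<in> {1..k}" "m \<in> {1..k}" "u i < (v(k := Suc n)) m"
        "(v(k := Suc n)) m < (v(k := Suc n)) i"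
      have mk: "m \<noteq> k" using * vn[of i] by (auto split: if_splits)
      show "u m = (v(k := Suc n)) m \<and> m < i"
      proof (cases "i = k")
        case False
        then show ?thesis using * mk pieri_between[OF P *(1,2)] by auto
      next
        case True
        have "v m \<noteq> v k" using mk permutes_eq_iff[OF pv] by simp
        then show ?thesis using * mk True pieri_between[OF P *(1,2)] d[of m] by (cases "v m < v k") auto
      qed
    qed
  }
  {
    assume P: "pieri k u (v(k := Suc n))"
    have uk: "u k \<noteq> v m" if "m \<in> {1..<k}" for m
      using pieri_source[OF P kk, of m] that un[OF kk] by auto
    have ukv: "u k \<le> v k" using Sdec_max_rest[OF v k(1) un[OF kk]] uk by blast
    \<comment> \<open>If u k < v i, the run of pipe k would pass over column v i, and pipe i would
      have to be straight.\<close>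
    have left: "v i < u k" if "i \<in> {1..<k}" "u i < v i" for i
    proof -
      have "\<not> u k < v i" using pieri_between[OF P kk, of i] that vn[of i] by auto
      then show ?thesis using uk[OF that(1)] by simp
    qed
    show "pieri k u v"
    proof (rule pieriI)
      fix i assume "i \<in> {1..k}"
      then show "u i \<le> v i" using pieri_le[OF P, of i] ukv by (cases "i = k") auto
    next
      fix i m assume *: "i \<in> {1..k}" "m \<in> {1..k}" "u i < v i" "u i = v m"
      show False
      proof (cases "i = k")
        case True
        then show False using uk[of m] * by (cases "m = k") auto
      next
        case False
        then show False using left[of i] pieri_source[OF P *(1,2)] * ukv by (cases "m = k") auto
      qed
    next
      fix i m assume *: "i \<in> {1..k}" "m \<in> {1..k}" "u i < v m" "v m < v i"
      show "u m = v m \<and> m < i"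
      proof (cases "m = k")
        case True
        then show ?thesis using left[of i] * ukv by (cases "i = k") auto
      next
        case False
        then show ?thesis using pieri_between[OF P *(1,2)] * vn[OF *(2)] by (cases "i = k") auto
      qed
    qed
  }
qed

section \<open>Tracing pipes\<close>

text \<open>\<open>E r i\<close> stands for the column in which pipe i leaves row r. Pipe r, which
  comes in through the right boundary, is treated like the others by starting it in a virtual column
  n+1.\<close>

definition entry :: "nat \<Rightarrow> (nat \<Rightarrow> nat \<Rightarrow> nat) \<Rightarrow> nat \<Rightarrow> nat \<Rightarrow> nat" where
  "entry n E r = (E (r - 1))(r := Suc n)"

lemma entry_same [simp]: "entry n E r r = Suc n"
  by (simp add: entry_def)

lemma entry_less [simp]: "i < r \<Longrightarrow> entry n E r i = E (r - 1) i"
  by (simp add: entry_def)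

text \<open>If two pipes left in the same column, the one entering further right would run over the
  entry of the other, which would then be straight; so a moving pipe would land on an entry
  column.\<close>

lemma flow_inj:
  assumes F: "flow k u a" and a: "inj_on a {1..k}"
  shows "inj_on u {1..k}"
proof (rule inj_onI, rule ccontr)
  have main: False if im: "i \<in> {1..k}" "m \<in> {1..k}" and eq: "u i = u m" and lt: "a i < a m" for i m
  proof -
    have "u m < a m" using flow_le[OF F im(1)] eq lt by simp
    then have "u i \<noteq> a i" using flow_source[OF F im(2,1)] eq by simp
    moreover have "u i = a i" using flow_between[OF F im(2,1)] flow_le[OF F im(1)] eq lt calculation
      by simp
    ultimately show False by simp
  qed
  fix i m assume im: "i \<in> {1..k}" "m \<in> {1..k}" "u i = u m" "i \<noteq> m"
  then have "a i \<noteq> a m" using a by (auto dest: inj_onD)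
  then show False using main[of i m] main[of m i] im by linarith
qed

definition flip :: "(nat \<Rightarrow> nat) \<Rightarrow> (nat \<Rightarrow> nat) \<Rightarrow> nat \<Rightarrow> nat \<Rightarrow> bool" where
  "flip u a i m \<longleftrightarrow> u i < a m \<and> a m < a i \<or> u m < a i \<and> a i < a m"

text \<open>A pipe running over the entry column of another forces that one to be straight and ends
  up on its other side. Otherwise the pipe on the right stays to the right of the entry, hence of
  the exit, of the one on the left.\<close>

lemma flip_iff:
  assumes F: "flow k u a" and a: "inj_on a {1..k}" and im: "i \<in> {1..k}" "m \<in> {1..k}" "i \<noteq> m"
  shows "flip u a i m \<longleftrightarrow> (u i < u m) \<noteq> (a i < a m)"
proof -
  have neq: "a i \<noteq> a m" using a im by (auto dest: inj_onD)
  have main: "u q < a p \<longleftrightarrow> \<not> u p < u q" if pq: "p \<in> {1..k}" "q \<in> {1..k}" and lt: "a p < a q" for p q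
  proof
    assume "u q < a p"
    then show "\<not> u p < u q" using flow_between[OF F pq(2,1)] lt by simp
  next
    assume *: "\<not> u p < u q"
    then have "u q \<le> a p" using flow_le[OF F pq(1)] by simp
    moreover have "u q \<noteq> a p" using flow_source[OF F pq(2,1)] lt calculation by simp
    ultimately show "u q < a p" by simp
  qed
  have "u i \<noteq> u m" using flow_inj[OF F a] im by (auto dest: inj_onD)
  then show ?thesis using main[of i m] main[of m i] im neq by (auto simp: flip_def)
qed

text \<open>\<open>E\<close> is a proposed trajectory of all pipes. Keeping it abstract lets the
  tracing lemmas serve both the columns read off a given filling and the permutations from which a
  filling is built. The guard \<open>entry n E r i \<le> n\<close> spares the virtual
  column.\<close>

definition row_traced :: "nat \<Rightarrow> filling \<Rightarrow> (nat \<Rightarrow> nat \<Rightarrow> nat) \<Rightarrow> nat \<Rightarrow> bool" where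
  "row_traced n D E r \<longleftrightarrow> (\<forall>i\<in>{1..r}.
     1 \<le> E r i \<and> E r i \<le> n \<and> E r i \<le> entry n E r i \<and> entry n E r i \<le> Suc n \<and>
     (E r i = entry n E r i \<longrightarrow> D r (E r i) \<in> {Vert, Cross}) \<and>
     (E r i < entry n E r i \<longrightarrow> D r (E r i) = ElbowRB \<and>
        (entry n E r i \<le> n \<longrightarrow> D r (entry n E r i) = ElbowTL) \<and>
        (\<forall>c. E r i < c \<longrightarrow> c < entry n E r i \<longrightarrow> D r c \<in> {Horiz, Cross})))"

lemma row_tracedD:
  assumes "row_traced n D E r" "i \<in> {1..r}"
  shows "1 \<le> E r i" "E r i \<le> n" "E r i \<le> entry n E r i" "entry n E r i \<le> Suc n"
    "E r i = entry n E r i \<Longrightarrow> D r (E r i) \<in> {Vert, Cross}"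
    "E r i < entry n E r i \<Longrightarrow> D r (E r i) = ElbowRB"
    "E r i < entry n E r i \<Longrightarrow> entry n E r i \<le> n \<Longrightarrow> D r (entry n E r i) = ElbowTL"
    "E r i < c \<Longrightarrow> c < entry n E r i \<Longrightarrow> D r c \<in> {Horiz, Cross}"
  using assms unfolding row_traced_def by (blast, blast, blast, blast, blast, blast, blast) (meson assms less_trans row_traced_def)

lemma row_traced_cong:
  assumes "\<And>i. i \<in> {1..r} \<Longrightarrow> E r i = E' r i" "\<And>i. i \<in> {1..<r} \<Longrightarrow> E (r - 1) i = E' (r - 1) i"
    "D r = D' r"
  shows "row_traced n D E r \<longleftrightarrow> row_traced n D' E' r"
proof -
  have "entry n E r i = entry n E' r i" if "i \<in> {1..r}" for i
    using assms(2)[of i] that by (cases "i = r") auto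
  then show ?thesis using assms(1,3) unfolding row_traced_def by simp
qed

lemma row_traced_bot:
  assumes "row_traced n D E r" "i \<in> {1..r}"
  shows "has_bot (D r (E r i))"
  using row_tracedD(3,5,6)[OF assms] by (cases "E r i < entry n E r i") auto

lemma row_traced_top:
  assumes "row_traced n D E r" "i \<in> {1..<r}"
  shows "D r (entry n E r i) \<in> {Vert, Cross, ElbowTL} \<or> entry n E r i = Suc n"
  using row_tracedD(3,4,5,7)[OF assms(1), of i] assms(2) by (cases "E r i < entry n E r i") auto

text \<open>An \<open>ElbowRB\<close> has no top edge, so a moving pipe does not exit where another
  one enters; and a tile inside a horizontal run is no \<open>ElbowTL\<close>, so a pipe entering
  there goes straight down.\<close>

lemma row_traced_flow:
  assumes T: "row_traced n D E r"
  shows "flow r (E r) (entry n E r)"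
  unfolding flow_def
proof (intro conjI ballI impI)
  fix i assume i: "i \<in> {1..r}"
  show "E r i \<le> entry n E r i" by (rule row_tracedD(3)[OF T i])
next
  fix i m assume im: "i \<in> {1..r}" "m \<in> {1..r}" and lt: "E r i < entry n E r i"
  have e: "D r (E r i) = ElbowRB" "E r i \<le> n" using row_tracedD[OF T im(1)] lt by auto
  show "E r i \<noteq> entry n E r m"
  proof (cases "m = r")
    case False
    then show ?thesis using row_traced_top[OF T, of m] im e by auto
  qed (use e in auto)
next
  fix i m assume im: "i \<in> {1..r}" "m \<in> {1..r}"
    and lt: "E r i < entry n E r m" "entry n E r m < entry n E r i"
  then have "D r (entry n E r m) \<in> {Horiz, Cross}" using row_tracedD(8)[OF T im(1)] by blast
  moreover have "entry n E r m \<le> n" using lt row_tracedD(4)[OF T im(1)] by simp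
  ultimately show "E r m = entry n E r m"
    using row_tracedD(3,7)[OF T im(2)] by fastforce
qed

text \<open>Every step goes one cell down or left, so r + (n - c) increases by one per step and
  serves as a clock. The first alternative is a pipe that has left the grid and rests there.\<close>

lemma pipe_state_traced:
  assumes T: "\<And>r. r \<in> {1..k} \<Longrightarrow> row_traced n D E r" and i: "i \<in> {1..k}"
  shows "pipe_state n k D i t = (r, c, d) \<Longrightarrow>
    r = Suc k \<and> c = E k i \<and> Suc k + (n - c) \<le> i + t \<or>
    i \<le> r \<and> r \<le> k \<and> r + (n - c) = i + t \<and> E r i \<le> c \<and> c \<le> n \<and>
    (if d = FromTop then c = entry n E r i else c < entry n E r i)"
proof (induction t arbitrary: r c d)
  case 0
  then have [simp]: "r = i" "c = n" "d = FromRight" by (auto simp: pipe_state_def)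
  have "E i i \<le> n" using row_tracedD(2)[OF T[OF i], of i] i by simp
  then show ?case using i by simp
next
  case (Suc t)
  obtain r' c' d' where s: "pipe_state n k D i t = (r', c', d')" by (cases "pipe_state n k D i t") auto
  then have step: "pstep k D (r', c', d') = (r, c, d)"
    using Suc.prems by (simp add: pipe_state_def)
  from Suc.IH[OF s] show ?case
  proof
    assume "r' = Suc k \<and> c' = E k i \<and> Suc k + (n - c') \<le> i + t"
    then show ?case using step by (auto simp: pstep_def)
  next
    assume *: "i \<le> r' \<and> r' \<le> k \<and> r' + (n - c') = i + t \<and> E r' i \<le> c' \<and> c' \<le> n \<and>
      (if d' = FromTop then c' = entry n E r' i else c' < entry n E r' i)"
    have r': "r' \<in> {1..k}" and ir: "i \<in> {1..r'}" using * i by auto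
    note tr = row_tracedD[OF T[OF r'] ir]
    have c1: "1 \<le> c'" using tr(1) * by simp
    have next_row: ?case if "r = Suc r'" "c = E r' i" "c' = c" "d = FromTop"
    proof (cases "r' = k")
      case True
      then show ?thesis using that * by auto
    next
      case False
      then have "Suc r' \<in> {1..k}" "i \<in> {1..Suc r'}" "i < Suc r'" using r' ir by auto
      then show ?thesis using that * row_tracedD(3)[OF T[of "Suc r'"], of i] by auto
    qed
    show ?case
    proof (cases d')
      case FromTop
      then have ce: "c' = entry n E r' i" using * by simp
      show ?thesis
      proof (cases "E r' i = entry n E r' i")
        case True
        then have "D r' c' \<in> {Vert, Cross}" using tr(5) ce by simp
        then have "r = Suc r'" "c = c'" "d = FromTop" using step FromTop r' c1 by (auto simp: pstep_def)
        then show ?thesis using next_row True ce by simp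
      next
        case False
        then have lt: "E r' i < entry n E r' i" using tr(3) by simp
        then have "D r' c' = ElbowTL" using tr(7) ce * by simp
        then have "r = r'" "c = c' - 1" "d = FromRight" using step FromTop r' c1 by (auto simp: pstep_def)
        then show ?thesis using * lt ce c1 by auto
      qed
    next
      case FromRight
      then have ce: "c' < entry n E r' i" using * by simp
      then have lt: "E r' i < entry n E r' i" using * by simp
      show ?thesis
      proof (cases "c' = E r' i")
        case True
        then have "D r' c' = ElbowRB" using tr(6) lt by simp
        then have "r = Suc r'" "c = c'" "d = FromTop" using step FromRight r' c1 by (auto simp: pstep_def)
        then show ?thesis using next_row True by simp
      next
        case False
        then have "D r' c' \<in> {Horiz, Cross}" using tr(8)[of c'] ce * by simp
        then have "r = r'" "c = c' - 1" "d = FromRight" using step FromRight r' c1 by (auto simp: pstep_def)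
        then show ?thesis using * ce c1 False by auto
      qed
    qed
  qed
qed

lemma pipe_exit_traced:
  assumes T: "\<And>r. r \<in> {1..k} \<Longrightarrow> row_traced n D E r" and i: "i \<in> {1..k}"
  shows "pipe_exit n k D i = E k i"
proof -
  obtain r c d where s: "pipe_state n k D i (k + n) = (r, c, d)" by (cases "pipe_state n k D i (k + n)") auto
  \<comment> \<open>Inside the grid the clock shows at most k + n, which is less than i + (k +
    n).\<close>
  from pipe_state_traced[OF T i s] have "c = E k i" using i by auto
  then show ?thesis using s by (simp add: pipe_exit_def)
qed

lemma row_traced_antimono:
  assumes T: "\<And>r. r \<in> {1..k} \<Longrightarrow> row_traced n D E r" and "i \<in> {1..r}" "r \<le> s" "s \<le> k"
  shows "E s i \<le> E r i"
  using assms(3,4)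
proof (induction s rule: dec_induct)
  case (step s)
  then have "E (Suc s) i \<le> E s i" using row_tracedD(3)[OF T[of "Suc s"], of i] assms(2) by auto
  then show ?case using step by simp
qed simp

lemma pipe_cells_traced:
  assumes T: "\<And>r. r \<in> {1..k} \<Longrightarrow> row_traced n D E r" and i: "i \<in> {1..k}"
  shows "pipe_cells n k D i = {(r, c). i \<le> r \<and> r \<le> k \<and> E r i \<le> c \<and> c \<le> entry n E r i \<and> c \<le> n}"
proof (intro set_eqI iffI)
  fix x assume "x \<in> pipe_cells n k D i"
  then obtain r c d t where x: "x = (r, c)" "r \<le> k" and s: "pipe_state n k D i t = (r, c, d)"
    by (auto simp: pipe_cells_def) (metis prod.collapse)
  show "x \<in> {(r, c). i \<le> r \<and> r \<le> k \<and> E r i \<le> c \<and> c \<le> entry n E r i \<and> c \<le> n}"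
    using pipe_state_traced[OF T i s] x by (auto split: if_splits)
next
  fix x assume "x \<in> {(r, c). i \<le> r \<and> r \<le> k \<and> E r i \<le> c \<and> c \<le> entry n E r i \<and> c \<le> n}"
  then obtain r c where x: "x = (r, c)" "i \<le> r" "r \<le> k" "E r i \<le> c" "c \<le> entry n E r i" "c \<le> n" by auto
  \<comment> \<open>The only time at which the clock allows the pipe to be in the cell (r,
    c).\<close>
  define t where "t = (r - i) + (n - c)"
  obtain r' c' d where s: "pipe_state n k D i t = (r', c', d)" by (cases "pipe_state n k D i t") auto
  have it: "i + t = r + (n - c)" using x by (simp add: t_def)
  have anti: "E q i \<le> E p i" if "i \<le> p" "p \<le> q" "q \<le> k" for p q
    by (rule row_traced_antimono[where k = k and n = n and D = D]) (use T that i in auto)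
  from pipe_state_traced[OF T i s] have "r' = r \<and> c' = c"
  proof
    assume *: "r' = Suc k \<and> c' = E k i \<and> Suc k + (n - c') \<le> i + t"
    then show ?thesis using it x anti[of r k] by auto
  next
    assume *: "i \<le> r' \<and> r' \<le> k \<and> r' + (n - c') = i + t \<and> E r' i \<le> c' \<and> c' \<le> n \<and>
       (if d = FromTop then c' = entry n E r' i else c' < entry n E r' i)"
    then have ce: "c' \<le> entry n E r' i" by (auto split: if_splits)
    \<comment> \<open>A path going only down and left cannot contain two different cells with the
      same clock value.\<close>
    have "\<not> r' < r"
    proof
      assume "r' < r"
      then have "E (r - 1) i \<le> E r' i" "entry n E r i = E (r - 1) i" using anti[of r' "r - 1"] * x by auto
      then show False using \<open>r' < r\<close> * it x by linarith
    qed
    moreover have "\<not> r < r'"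
    proof
      assume "r < r'"
      then have "E (r' - 1) i \<le> E r i" "entry n E r' i = E (r' - 1) i" using anti[of r "r' - 1"] * x by auto
      then show False using \<open>r < r'\<close> * it x ce by linarith
    qed
    ultimately show ?thesis using * it x by linarith
  qed
  then show "x \<in> pipe_cells n k D i" using s x i by (auto simp: pipe_cells_def intro!: exI[of _ t])
qed

text \<open>At a crossing one pipe goes straight down, inside the horizontal run of the other; this
  is a flip, and the straight pipe is the one entering further left. So a pair crosses at most once
  per row, and counting crossings amounts to counting rows.\<close>

lemma crossings_traced:
  assumes T: "\<And>r. r \<in> {1..k} \<Longrightarrow> row_traced n D E r"
    and inj: "\<And>r. r \<in> {1..k} \<Longrightarrow> inj_on (entry n E r) {1..r}"
    and im: "1 \<le> i" "i < m" "m \<le> k"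
  shows "crossings n k D i m =
    (\<lambda>r. (r, min (entry n E r i) (entry n E r m))) ` {r \<in> {m..k}. flip (E r) (entry n E r) i m}"
proof -
  have row: "D r c = Cross \<and> E r i \<le> c \<and> c \<le> entry n E r i \<and> E r m \<le> c \<and> c \<le> entry n E r m \<and> c \<le> n \<longleftrightarrow>
      flip (E r) (entry n E r) i m \<and> c = min (entry n E r i) (entry n E r m)"
    if r: "m \<le> r" "r \<le> k" for r c
  proof -
    let ?a = "entry n E r" and ?u = "E r"
    have rk: "r \<in> {1..k}" and i: "i \<in> {1..r}" and m: "m \<in> {1..r}" using im r by auto
    note ti = row_tracedD[OF T[OF rk] i] and tm = row_tracedD[OF T[OF rk] m]
    note F = row_traced_flow[OF T[OF rk]]
    have neq: "?a i \<noteq> ?a m" using inj_on_eq_iff[OF inj[OF rk] i m] im by simp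
    \<comment> \<open>The ends of a horizontal run are elbows, so a pipe meets a crossing tile
      either straight down or in the interior of its run.\<close>
    have X: "?u p = c \<and> ?a p = c \<or> ?u p < c \<and> c < ?a p"
      if "D r c = Cross" "?u p \<le> c" "c \<le> ?a p" "c \<le> n" "p \<in> {1..r}" for p
    proof -
      have "?u p < ?a p \<Longrightarrow> c \<noteq> ?u p \<and> c \<noteq> ?a p"
        using row_tracedD(6,7)[OF T[OF rk] that(5)] that by auto
      then show ?thesis using that by linarith
    qed
    show ?thesis
    proof
      assume *: "D r c = Cross \<and> ?u i \<le> c \<and> c \<le> ?a i \<and> ?u m \<le> c \<and> c \<le> ?a m \<and> c \<le> n"
      then consider "?u i = c" "?a i = c" "?u m < c" "c < ?a m" | "?u m = c" "?a m = c" "?u i < c" "c < ?a i"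
        | "?u i < c" "c < ?a i" "?u m < c" "c < ?a m"
        using X[OF _ _ _ _ i] X[OF _ _ _ _ m] neq by metis
      then show "flip ?u ?a i m \<and> c = min (?a i) (?a m)"
      proof cases
        \<comment> \<open>Two pipes cannot both run horizontally through the same tile.\<close>
        case 3
        then have False
          using flow_between[OF F i m] flow_between[OF F m i] neq by (cases "?a i < ?a m") auto
        then show ?thesis ..
      qed (auto simp: flip_def)
    next
      assume *: "flip ?u ?a i m \<and> c = min (?a i) (?a m)"
      have main: "D r (?a q) = Cross \<and> ?u q = ?a q \<and> ?a q \<le> n"
        if lt: "?u p < ?a q" "?a q < ?a p" and pq: "p \<in> {1..r}" "q \<in> {1..r}" for p q
      proof -
        have "?u q = ?a q" using flow_between[OF F pq lt] .
        moreover then have "D r (?a q) \<in> {Vert, Cross}" using row_tracedD(5)[OF T[OF rk] pq(2)] by simp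
        moreover have "D r (?a q) \<in> {Horiz, Cross}" using row_tracedD(8)[OF T[OF rk] pq(1) lt] .
        ultimately show ?thesis using lt row_tracedD(4)[OF T[OF rk] pq(1)] by auto
      qed
      from * consider "?u i < ?a m" "?a m < ?a i" "c = ?a m" | "?u m < ?a i" "?a i < ?a m" "c = ?a i"
        unfolding flip_def by force
      then show "D r c = Cross \<and> ?u i \<le> c \<and> c \<le> ?a i \<and> ?u m \<le> c \<and> c \<le> ?a m \<and> c \<le> n"
        using main[OF _ _ i m] main[OF _ _ m i] by cases auto
    qed
  qed
  have "crossings n k D i m = {(r, c). m \<le> r \<and> r \<le> k \<and> D r c = Cross \<and> E r i \<le> c \<and> c \<le> entry n E r i \<and>
      E r m \<le> c \<and> c \<le> entry n E r m \<and> c \<le> n}"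
  proof -
    have "pipe_cells n k D p = {(r, c). p \<le> r \<and> r \<le> k \<and> E r p \<le> c \<and> c \<le> entry n E r p \<and> c \<le> n}"
      if "p \<in> {1..k}" for p by (rule pipe_cells_traced[OF T that])
    then show ?thesis using im unfolding crossings_def by auto
  qed
  also have "\<dots> = {(r, c). m \<le> r \<and> r \<le> k \<and> flip (E r) (entry n E r) i m \<and> c = min (entry n E r i) (entry n E r m)}"
    using row by blast
  also have "\<dots> = (\<lambda>r. (r, min (entry n E r i) (entry n E r m))) ` {r \<in> {m..k}. flip (E r) (entry n E r) i m}"
    by auto
  finally show ?thesis .
qed

lemma card_crossings_traced:
  assumes "\<And>r. r \<in> {1..k} \<Longrightarrow> row_traced n D E r"
    and "\<And>r. r \<in> {1..k} \<Longrightarrow> inj_on (entry n E r) {1..r}"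
    and "1 \<le> i" "i < m" "m \<le> k"
  shows "card (crossings n k D i m) = card {r \<in> {m..k}. flip (E r) (entry n E r) i m}"
proof -
  have "crossings n k D i m =
    (\<lambda>r. (r, min (entry n E r i) (entry n E r m))) ` {r \<in> {m..k}. flip (E r) (entry n E r) i m}"
    by (rule crossings_traced) (use assms in auto)
  then show ?thesis by (simp add: card_image inj_on_def)
qed

section \<open>Bumpless pipe dreams as sequences of permutations\<close>

text \<open>The arguments tell which of the top, bottom and right edges are open; the left edge
  follows. Combinations that belong to no tile get an arbitrary value and do not occur in a
  \<open>flow\<close>.\<close>

definition flow_tile :: "bool \<Rightarrow> bool \<Rightarrow> bool \<Rightarrow> tile" where
  "flow_tile T B R = (if T then if R then Cross else if B then Vert else ElbowTL
     else if R then if B then ElbowRB else Horiz else Blank)"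

definition flow_fill :: "nat \<Rightarrow> (nat \<Rightarrow> nat \<Rightarrow> nat) \<Rightarrow> filling" where
  "flow_fill n E r c = (if r \<in> {1..n} \<and> c \<in> {1..n} then
     flow_tile (c \<in> E (r - 1) ` {1..<r}) (c \<in> E r ` {1..r}) (\<exists>i\<in>{1..r}. E r i \<le> c \<and> c < entry n E r i)
     else Blank)"

text \<open>The local edge conditions are separated from the crossing bound: they alone determine
  the trajectories, in terms of which the bound is then expressed.\<close>

definition matched :: "nat \<Rightarrow> filling \<Rightarrow> bool" where
  "matched n D \<longleftrightarrow>
     (\<forall>r c. \<not> (1 \<le> r \<and> r \<le> n \<and> 1 \<le> c \<and> c \<le> n) \<longrightarrow> D r c = Blank) \<and>
     (\<forall>r\<in>{1..n}. \<forall>c\<in>{1..<n}. has_right (D r c) = has_left (D r (c + 1))) \<and>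
     (\<forall>r\<in>{1..<n}. \<forall>c\<in>{1..n}. has_bot (D r c) = has_top (D (r + 1) c)) \<and>
     (\<forall>r\<in>{1..n}. \<not> has_left (D r 1)) \<and>
     (\<forall>c\<in>{1..n}. \<not> has_top (D 1 c)) \<and>
     (\<forall>r\<in>{1..n}. has_right (D r n))"

lemma kBPD_iff_matched:
  "kBPD n n D \<longleftrightarrow> matched n D \<and>
     (\<forall>i j. 1 \<le> i \<longrightarrow> i < j \<longrightarrow> j \<le> n \<longrightarrow> card (crossings n n D i j) \<le> 1)"
  by (simp add: kBPD_def matched_def)

section \<open>Trajectories in a matched filling\<close>

lemma matchedD:
  assumes "matched n D"
  shows "\<not> (1 \<le> r \<and> r \<le> n \<and> 1 \<le> c \<and> c \<le> n) \<Longrightarrow> D r c = Blank"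
    "r \<in> {1..n} \<Longrightarrow> c \<in> {1..<n} \<Longrightarrow> has_right (D r c) = has_left (D r (Suc c))"
    "r \<in> {1..<n} \<Longrightarrow> c \<in> {1..n} \<Longrightarrow> has_bot (D r c) = has_top (D (Suc r) c)"
    "r \<in> {1..n} \<Longrightarrow> \<not> has_left (D r 1)"
    "c \<in> {1..n} \<Longrightarrow> \<not> has_top (D 1 c)"
    "r \<in> {1..n} \<Longrightarrow> has_right (D r n)"
  using assms unfolding matched_def by simp_all

text \<open>Followed to the left, the run cannot leave the grid, so it must end at an elbow that
  turns down.\<close>

lemma matched_left_run:
  assumes D: "matched n D" and r: "r \<in> {1..n}"
  shows "c \<in> {1..n} \<Longrightarrow> has_right (D r c) \<Longrightarrow>
    \<exists>b. 1 \<le> b \<and> b \<le> c \<and> D r b = ElbowRB \<and> (\<forall>x. b < x \<longrightarrow> x \<le> c \<longrightarrow> D r x \<in> {Horiz, Cross})"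
proof (induction c)
  case (Suc c)
  show ?case
  proof (cases "D r (Suc c) = ElbowRB")
    case True
    then show ?thesis by (intro exI[of _ "Suc c"]) auto
  next
    case False
    then have t: "D r (Suc c) \<in> {Horiz, Cross}" using Suc.prems(2) by (cases "D r (Suc c)") auto
    then have l: "has_left (D r (Suc c))" by auto
    then have "c \<noteq> 0" using matchedD(4)[OF D r] by (cases "c = 0") auto
    then have c: "c \<in> {1..n}" "c \<in> {1..<n}" using Suc.prems by auto
    then have "has_right (D r c)" using matchedD(2)[OF D r] l by simp
    then obtain b where b: "1 \<le> b" "b \<le> c" "D r b = ElbowRB" "\<forall>x. b < x \<longrightarrow> x \<le> c \<longrightarrow> D r x \<in> {Horiz, Cross}"
      using Suc.IH c by blast
    then show ?thesis using t by (intro exI[of _ b]) (auto simp: le_Suc_eq)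
  qed
qed simp

text \<open>The trajectory read off a filling: go straight down or slide left to the nearest elbow.
  The update at \<open>Suc r\<close> is \<open>entry\<close> written out, as the recursion has only
  the previous row at hand. Only pipe indices from 1 to r are meaningful.\<close>

primrec exits :: "nat \<Rightarrow> filling \<Rightarrow> nat \<Rightarrow> nat \<Rightarrow> nat" where
  "exits n D 0 = (\<lambda>i. Suc n)"
| "exits n D (Suc r) = (\<lambda>i. let a = ((exits n D r)(Suc r := Suc n)) i in
     if D (Suc r) a \<in> {Vert, Cross} then a
     else Max {b. b < a \<and> D (Suc r) b = ElbowRB})"

lemma exits_Suc_entry:
  "exits n D (Suc r) i = (let a = entry n (exits n D) (Suc r) i in
     if D (Suc r) a \<in> {Vert, Cross} then a
     else Max {b. b < a \<and> D (Suc r) b = ElbowRB})"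
  by (simp add: entry_def)

lemma matched_row_traced:
  assumes D: "matched n D"
  shows "r \<in> {1..n} \<Longrightarrow> row_traced n D (exits n D) r"
proof (induction r)
  case (Suc r)
  let ?E = "exits n D" and ?r = "Suc r"
  let ?a = "entry n ?E ?r"
  have r: "?r \<in> {1..n}" using Suc.prems .
  have "1 \<le> ?E ?r i \<and> ?E ?r i \<le> n \<and> ?E ?r i \<le> ?a i \<and> ?a i \<le> Suc n \<and>
     (?E ?r i = ?a i \<longrightarrow> D ?r (?E ?r i) \<in> {Vert, Cross}) \<and>
     (?E ?r i < ?a i \<longrightarrow> D ?r (?E ?r i) = ElbowRB \<and>
        (?a i \<le> n \<longrightarrow> D ?r (?a i) = ElbowTL) \<and>
        (\<forall>c. ?E ?r i < c \<longrightarrow> c < ?a i \<longrightarrow> D ?r c \<in> {Horiz, Cross}))" if i: "i \<in> {1..?r}" for i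
  proof -
    \<comment> \<open>The pipe arrives either in the virtual column, which is blank by convention
      and so makes it slide, or at a tile open at the top.\<close>
    have a: "?a i = Suc n \<and> D ?r (?a i) = Blank \<or> ?a i \<in> {1..n} \<and> has_top (D ?r (?a i))"
    proof (cases "i = ?r")
      case True
      then show ?thesis using matchedD(1)[OF D, of ?r "Suc n"] by simp
    next
      case False
      then have i': "i \<in> {1..r}" "r \<in> {1..n}" "r \<in> {1..<n}" using i r by auto
      note T = Suc.IH[OF i'(2)]
      have "?E r i \<in> {1..n}" using row_tracedD(1,2)[OF T i'(1)] by simp
      then show ?thesis using row_traced_bot[OF T i'(1)] matchedD(3)[OF D i'(3)] i' by simp
    qed
    show ?thesis
    proof (cases "D ?r (?a i) \<in> {Vert, Cross}")
      case True
      then have "?E ?r i = ?a i" by (simp add: exits_Suc_entry del: exits.simps)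
      then show ?thesis using a True by auto
    next
      case False
      have tl: "?a i \<le> n \<Longrightarrow> D ?r (?a i) = ElbowTL"
        using a False by (cases "D ?r (?a i)") auto
      \<comment> \<open>The cell just left of the arrival, where the horizontal run begins.\<close>
      obtain c where c: "?a i = Suc c" "c \<in> {1..n}" "has_right (D ?r c)"
      proof (cases "?a i = Suc n")
        case True
        then show ?thesis using that[of n] matchedD(6)[OF D r] r by auto
      next
        case False
        then have ai: "?a i \<in> {1..n}" "has_left (D ?r (?a i))" using a tl by auto
        then have "?a i \<noteq> 1" using matchedD(4)[OF D r] by auto
        then obtain c where "?a i = Suc c" "c \<noteq> 0" using ai by (cases "?a i") auto
        then show ?thesis using that[of c] matchedD(2)[OF D r, of c] ai by auto
      qed
      obtain b where b: "1 \<le> b" "b \<le> c" "D ?r b = ElbowRB" "\<And>x. b < x \<Longrightarrow> x \<le> c \<Longrightarrow> D ?r x \<in> {Horiz, Cross}"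
        using matched_left_run[OF D r c(2,3)] by blast
      have "Max {b. b < ?a i \<and> D ?r b = ElbowRB} = b"
      proof (rule Max_eqI)
        fix y assume "y \<in> {b. b < ?a i \<and> D ?r b = ElbowRB}"
        then show "y \<le> b" using b(4)[of y] c(1) by fastforce
      qed (use b c in auto)
      then have "?E ?r i = b" using False by (simp add: exits_Suc_entry del: exits.simps)
      then show ?thesis using b c tl by auto
    qed
  qed
  then show ?case unfolding row_traced_def by blast
qed simp

text \<open>Scanning leftwards from the boundary, where pipe r comes in, a run either continues or
  starts at an \<open>ElbowTL\<close>; the assumption \<open>top\<close> supplies the pipe coming
  down into it.\<close>

lemma row_traced_right_iff:
  assumes D: "matched n D" and T: "row_traced n D E r" and r: "r \<in> {1..n}"
    and top: "\<And>c. c \<in> {1..n} \<Longrightarrow> has_top (D r c) \<Longrightarrow> c \<in> E (r - 1) ` {1..<r}"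
    and c: "c \<in> {1..n}"
  shows "has_right (D r c) \<longleftrightarrow> (\<exists>i\<in>{1..r}. E r i \<le> c \<and> c < entry n E r i)"
proof
  have "c \<le> n" "1 \<le> c" using c by auto
  then show "has_right (D r c) \<Longrightarrow> \<exists>i\<in>{1..r}. E r i \<le> c \<and> c < entry n E r i"
  proof (induction c rule: inc_induct)
    case base
    have "E r r \<le> n" using row_tracedD(2)[OF T, of r] r by simp
    then show ?case using r by (intro bexI[of _ r]) auto
  next
    case (step c)
    then have l: "has_left (D r (Suc c))" using matchedD(2)[OF D r, of c] by simp
    show ?case
    proof (cases "has_right (D r (Suc c))")
      case True
      then obtain i where i: "i \<in> {1..r}" "E r i \<le> Suc c" "Suc c < entry n E r i" using step by auto
      then have "E r i \<noteq> Suc c" using row_tracedD(6)[OF T i(1)] l by auto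
      then show ?thesis using i by (intro bexI[of _ i]) auto
    next
      case False
      then have tl: "D r (Suc c) = ElbowTL" using l by (cases "D r (Suc c)") auto
      then obtain i where i: "i \<in> {1..<r}" "Suc c = E (r - 1) i" using top[of "Suc c"] step by auto
      then have i': "i \<in> {1..r}" "entry n E r i = Suc c" by auto
      then have "E r i \<noteq> Suc c" using row_tracedD(5)[OF T i'(1)] tl by auto
      then show ?thesis using i' row_tracedD(3)[OF T i'(1)] by (intro bexI[of _ i]) auto
    qed
  qed
next
  assume "\<exists>i\<in>{1..r}. E r i \<le> c \<and> c < entry n E r i"
  then obtain i where i: "i \<in> {1..r}" "E r i \<le> c" "c < entry n E r i" by auto
  show "has_right (D r c)"
    using row_tracedD(6)[OF T i(1)] row_tracedD(8)[OF T i(1), of c] i by (cases "E r i = c") auto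
qed

text \<open>The trajectories miss no segment: open top edges are inherited from the row above, and
  an open bottom edge belongs to a straight pipe or to the elbow that ends a traced run.\<close>

lemma matched_top_bot_iff:
  assumes D: "matched n D" and T: "\<And>r. r \<in> {1..n} \<Longrightarrow> row_traced n D E r"
  shows "r \<in> {1..n} \<Longrightarrow> c \<in> {1..n} \<Longrightarrow>
    (has_top (D r c) \<longleftrightarrow> c \<in> E (r - 1) ` {1..<r}) \<and> (has_bot (D r c) \<longleftrightarrow> c \<in> E r ` {1..r})"
proof (induction r arbitrary: c)
  case (Suc r)
  note r = Suc.prems(1)
  have top: "has_top (D (Suc r) x) \<longleftrightarrow> x \<in> E r ` {1..<Suc r}" if x: "x \<in> {1..n}" for x
  proof (cases "r = 0")
    case True
    then show ?thesis using matchedD(5)[OF D x] by simp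
  next
    case False
    then have "r \<in> {1..n}" "r \<in> {1..<n}" using r by auto
    then show ?thesis using Suc.IH[OF _ x] matchedD(3)[OF D _ x, of r]
      by (simp add: atLeastLessThanSuc_atLeastAtMost)
  qed
  have "c \<in> E (Suc r) ` {1..Suc r}" if bot: "has_bot (D (Suc r) c)"
  proof (cases "has_top (D (Suc r) c)")
    case True
    then obtain i where i: "i \<in> {1..<Suc r}" "c = E r i" using top Suc.prems by auto
    then have i': "i \<in> {1..Suc r}" "entry n E (Suc r) i = c" by auto
    have "D (Suc r) c \<noteq> ElbowTL" using bot by auto
    then have "E (Suc r) i = c" using row_tracedD(3,7)[OF T[OF r] i'(1)] i' Suc.prems by fastforce
    then show ?thesis using i' by auto
  next
    case False
    then have rb: "D (Suc r) c = ElbowRB" using bot by (cases "D (Suc r) c") auto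
    then obtain i where i: "i \<in> {1..Suc r}" "E (Suc r) i \<le> c" "c < entry n E (Suc r) i"
      using row_traced_right_iff[OF D T[OF r] r _ Suc.prems(2)] top by auto
    then have "E (Suc r) i = c" using row_tracedD(8)[OF T[OF r] i(1), of c] rb by fastforce
    then show ?thesis using i by auto
  qed
  moreover have "has_bot (D (Suc r) c)" if "c \<in> E (Suc r) ` {1..Suc r}"
    using that row_traced_bot[OF T[OF r]] by auto
  ultimately show ?case using top Suc.prems by auto
qed simp

lemma matched_eq_flow_fill:
  assumes D: "matched n D" and T: "\<And>r. r \<in> {1..n} \<Longrightarrow> row_traced n D E r"
  shows "D = flow_fill n E"
proof (intro ext)
  fix r c
  show "D r c = flow_fill n E r c"
  proof (cases "r \<in> {1..n} \<and> c \<in> {1..n}")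
    case False
    then show ?thesis using matchedD(1)[OF D] by (auto simp: flow_fill_def)
  next
    case True
    then have r: "r \<in> {1..n}" and c: "c \<in> {1..n}" by auto
    have tb: "has_top (D r x) \<longleftrightarrow> x \<in> E (r - 1) ` {1..<r}" "has_bot (D r x) \<longleftrightarrow> x \<in> E r ` {1..r}"
      if "x \<in> {1..n}" for x
      using matched_top_bot_iff[OF D T r that] by auto
    have right: "has_right (D r c) \<longleftrightarrow> (\<exists>i\<in>{1..r}. E r i \<le> c \<and> c < entry n E r i)"
      using row_traced_right_iff[OF D T[OF r] r _ c] tb by blast
    have "flow_fill n E r c = flow_tile (has_top (D r c)) (has_bot (D r c)) (has_right (D r c))"
      unfolding flow_fill_def tb[OF c] right using True by simp
    also have "\<dots> = D r c" by (cases "D r c") (auto simp: flow_tile_def)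
    finally show ?thesis by simp
  qed
qed

text \<open>Indexed by the number of rows, this is a chain read backwards, with the additional
  member \<open>U n\<close>. The relation at k = n forces \<open>U (n - 1) = U n\<close>.\<close>

definition perm_seq :: "nat \<Rightarrow> (nat \<Rightarrow> nat \<Rightarrow> nat) \<Rightarrow> bool" where
  "perm_seq n U \<longleftrightarrow> (\<forall>k\<le>n. U k \<in> Sdec n k) \<and> (\<forall>k\<in>{1..n}. pieri k (U k) (U (k - 1)))"

section \<open>The crossing bound as a condition on single rows\<close>

lemma inj_on_entry:
  assumes "inj_on (E (r - 1)) {1..<r}" "\<And>i. i \<in> {1..<r} \<Longrightarrow> E (r - 1) i \<le> n"
  shows "inj_on (entry n E r) {1..r}"
proof (rule inj_onI)
  fix i m assume *: "i \<in> {1..r}" "m \<in> {1..r}" "entry n E r i = entry n E r m"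
  show "i = m"
  proof (cases "i = r \<or> m = r")
    case True
    then show ?thesis using * assms(2)[of i] assms(2)[of m] by (cases "i = r"; cases "m = r") auto
  next
    case False
    then show ?thesis using * assms(1) by (auto dest: inj_onD)
  qed
qed

lemma traced_inj:
  assumes T: "\<And>r. r \<in> {1..n} \<Longrightarrow> row_traced n D E r"
  shows "r \<le> n \<Longrightarrow> inj_on (E r) {1..r}"
proof (induction r)
  case (Suc r)
  have "inj_on (entry n E (Suc r)) {1..Suc r}"
  proof (rule inj_on_entry)
    show "inj_on (E (Suc r - 1)) {1..<Suc r}"
      using Suc by (simp add: atLeastLessThanSuc_atLeastAtMost)
    fix i assume "i \<in> {1..<Suc r}"
    then show "E (Suc r - 1) i \<le> n" using row_tracedD(2)[OF T[of r], of i] Suc.prems by auto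
  qed
  then show ?case using flow_inj[OF row_traced_flow[OF T[of "Suc r"]]] Suc.prems by auto
qed simp

text \<open>A violation in row r is a crossing of pipes i < m in which m enters the row to the left
  of i. But m first came in from the right of i, so the two have crossed before.\<close>

lemma pieri_of_few_crossings:
  assumes T: "\<And>r. r \<in> {1..n} \<Longrightarrow> row_traced n D E r"
    and inj: "\<And>r. r \<in> {1..n} \<Longrightarrow> inj_on (entry n E r) {1..r}"
    and X: "\<And>i m. 1 \<le> i \<Longrightarrow> i < m \<Longrightarrow> m \<le> n \<Longrightarrow> card (crossings n n D i m) \<le> 1"
    and r: "r \<in> {1..n}"
  shows "pieri r (E r) (entry n E r)"
proof -
  have F: "flow s (E s) (entry n E s)" if "s \<in> {1..n}" for s by (rule row_traced_flow[OF T[OF that]])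
  have "m < i" if im: "i \<in> {1..r}" "m \<in> {1..r}" "E r i < entry n E r m" "entry n E r m < entry n E r i" for i m
  proof (rule ccontr)
    assume "\<not> m < i"
    moreover have "m \<noteq> i" using im by auto
    ultimately have lt: "i < m" by simp
    \<comment> \<open>Pipe r enters from the far right, so it cannot be the one entering further
      left.\<close>
    have mr: "m < r" using im row_tracedD(4)[OF T[OF r] im(1)] by (cases "m = r") auto
    let ?X = "{r \<in> {m..n}. flip (E r) (entry n E r) i m}"
    have "card ?X \<le> 1"
      using card_crossings_traced[of n n D E i m] T inj X[of i m] im lt mr r by auto
    have rX: "r \<in> ?X" using im mr r by (auto simp: flip_def)
    \<comment> \<open>With row r as the only flip, the original order persists through all rows
      above it.\<close>
    have ord: "E s i < E s m" if "m \<le> s" "s < r" for s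
      using that
    proof (induction s rule: dec_induct)
      case base
      have m: "m \<in> {1..n}" using lt mr r by auto
      have "\<not> flip (E m) (entry n E m) i m"
      proof
        assume "flip (E m) (entry n E m) i m"
        then have "{m, r} \<subseteq> ?X" using rX m by auto
        then have "card {m, r} \<le> card ?X" by (intro card_mono) auto
        then show False using \<open>card ?X \<le> 1\<close> mr by simp
      qed
      moreover have "entry n E m i < entry n E m m"
        using inj_on_eq_iff[OF inj[OF m], of i m] row_tracedD(4)[OF T[OF m], of i] im lt by simp
      ultimately show ?case using flip_iff[OF F[OF m] inj[OF m], of i m] im lt by auto
    next
      case (step s)
      have s: "Suc s \<in> {1..n}" using step r by auto
      have "\<not> flip (E (Suc s)) (entry n E (Suc s)) i m"
      proof
        assume "flip (E (Suc s)) (entry n E (Suc s)) i m"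
        then have "{Suc s, r} \<subseteq> ?X" using rX s step by auto
        then have "card {Suc s, r} \<le> card ?X" by (intro card_mono) auto
        then show False using \<open>card ?X \<le> 1\<close> step by simp
      qed
      moreover have "entry n E (Suc s) i < entry n E (Suc s) m" using step lt by simp
      ultimately show ?case using flip_iff[OF F[OF s] inj[OF s], of i m] im lt step by auto
    qed
    have "E (r - 1) i < E (r - 1) m" using ord[of "r - 1"] mr by simp
    then show False using im lt mr by simp
  qed
  then show ?thesis using F[OF r] unfolding pieri_def by blast
qed

text \<open>Under \<open>pieri\<close> every flip of i < m takes m from the right of i to its left.
  Without a flip the order is kept, so no second flip can follow.\<close>

lemma few_crossings_of_pieri:
  assumes T: "\<And>r. r \<in> {1..n} \<Longrightarrow> row_traced n D E r"
    and inj: "\<And>r. r \<in> {1..n} \<Longrightarrow> inj_on (entry n E r) {1..r}"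
    and P: "\<And>r. r \<in> {1..n} \<Longrightarrow> pieri r (E r) (entry n E r)"
    and im: "1 \<le> i" "i < m" "m \<le> n"
  shows "card (crossings n n D i m) \<le> 1"
proof -
  have F: "flow s (E s) (entry n E s)" if "s \<in> {1..n}" for s by (rule row_traced_flow[OF T[OF that]])
  let ?X = "{r \<in> {m..n}. flip (E r) (entry n E r) i m}"
  have flip: "entry n E r i < entry n E r m \<and> E r m < E r i" if "r \<in> ?X" for r
  proof -
    have r: "r \<in> {1..n}" and i: "i \<in> {1..r}" and m: "m \<in> {1..r}" using that im by auto
    have "\<not> (E r i < entry n E r m \<and> entry n E r m < entry n E r i)"
      using pieri_between[OF P[OF r] i m] im by auto
    then have lt: "entry n E r i < entry n E r m" using that by (auto simp: flip_def)
    moreover have "\<not> E r i < E r m" using flip_iff[OF F[OF r] inj[OF r] i m] im lt that by auto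
    moreover have "E r i \<noteq> E r m"
      using inj_on_eq_iff[OF flow_inj[OF F[OF r] inj[OF r]] i m] im by simp
    ultimately show ?thesis by simp
  qed
  have "\<not> a < b" if ab: "a \<in> ?X" "b \<in> ?X" for a b
  proof
    assume "a < b"
    have "E s m < E s i" if "a \<le> s" "s < b" for s
      using that
    proof (induction s rule: dec_induct)
      case base
      then show ?case using flip[OF ab(1)] by simp
    next
      case (step s)
      have s: "Suc s \<in> {1..n}" "i \<in> {1..Suc s}" "m \<in> {1..Suc s}" "i < Suc s" "m < Suc s"
        using step ab im by auto
      have lt: "entry n E (Suc s) m < entry n E (Suc s) i" using step s by simp
      then have "Suc s \<notin> ?X" using flip[of "Suc s"] by auto
      then have "\<not> flip (E (Suc s)) (entry n E (Suc s)) i m" using step ab by auto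
      then have "\<not> E (Suc s) i < E (Suc s) m"
        using flip_iff[OF F[OF s(1)] inj[OF s(1)] s(2,3)] im lt by auto
      moreover have "E (Suc s) i \<noteq> E (Suc s) m"
        using inj_on_eq_iff[OF flow_inj[OF F[OF s(1)] inj[OF s(1)]] s(2,3)] im by simp
      ultimately show ?case by simp
    qed
    from this[of "b - 1"] have "E (b - 1) m < E (b - 1) i" using \<open>a < b\<close> by simp
    moreover have "i < b" "m < b" using ab \<open>a < b\<close> im by auto
    ultimately show False using flip[OF ab(2)] by simp
  qed
  then have "\<forall>a\<in>?X. \<forall>b\<in>?X. a = b" by (meson linorder_neqE_nat)
  moreover have "finite ?X" by simp
  ultimately have "card ?X \<le> 1" using card_le_Suc0_iff_eq[of ?X] by (simp only: One_nat_def)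
  then show ?thesis using card_crossings_traced[of n n D E i m] T inj im by auto
qed

section \<open>The filling built from a sequence\<close>

lemma flow_disjoint:
  assumes F: "flow k u a" and a: "inj_on a {1..k}" and im: "i \<in> {1..k}" "m \<in> {1..k}"
    and "u m < a m" "u i < u m"
  shows "a i \<le> u m"
proof (rule ccontr)
  assume lt: "\<not> a i \<le> u m"
  have "i \<noteq> m" using assms(6) by auto
  then have "a i \<noteq> a m" using inj_on_eq_iff[OF a im] by simp
  \<comment> \<open>Whichever pipe enters further left lies on the run of the other and would have
    to be straight, yet both move.\<close>
  then show False
    using flow_between[OF F im] flow_between[OF F im(2,1)] lt assms(5,6) by (cases "a i < a m") auto
qed

text \<open>Top and right edges are open as prescribed by construction. For the bottom and left
  edges, the flow conditions exclude the combinations that no tile realises.\<close>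

lemma flow_tile_edges:
  assumes F: "flow k u a" and a: "inj_on a {1..k}"
    and t: "t = flow_tile (c \<in> a ` {1..k}) (c \<in> u ` {1..k}) (\<exists>i\<in>{1..k}. u i \<le> c \<and> c < a i)"
  shows "has_top t \<longleftrightarrow> c \<in> a ` {1..k}" "has_bot t \<longleftrightarrow> c \<in> u ` {1..k}"
    "has_right t \<longleftrightarrow> (\<exists>i\<in>{1..k}. u i \<le> c \<and> c < a i)"
    "has_left t \<longleftrightarrow> (\<exists>i\<in>{1..k}. u i < c \<and> c \<le> a i)"
proof -
  let ?T = "c \<in> a ` {1..k}" and ?B = "c \<in> u ` {1..k}" and ?R = "\<exists>i\<in>{1..k}. u i \<le> c \<and> c < a i"
    and ?L = "\<exists>i\<in>{1..k}. u i < c \<and> c \<le> a i"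
  have bot: "has_bot (flow_tile T B R) \<longleftrightarrow> T \<and> (R \<or> B) \<or> \<not> T \<and> R \<and> B"
    and left: "has_left (flow_tile T B R) \<longleftrightarrow> T \<and> (R \<or> \<not> B) \<or> \<not> T \<and> R \<and> \<not> B" for T B R
    by (auto simp: flow_tile_def)
  \<comment> \<open>An exit that is not an entry is the left end of a horizontal run.\<close>
  have BR: ?R if ?B "\<not> ?T"
  proof -
    from that obtain i where i: "i \<in> {1..k}" "c = u i" by auto
    then have "u i \<noteq> a i" using that by auto
    then show ?thesis using i flow_le[OF F i(1)] by (intro bexI[of _ i]) auto
  qed
  \<comment> \<open>An entry on a horizontal run belongs to a straight pipe, so the tile is a
    genuine crossing.\<close>
  have TR: "?B \<and> ?L" if ?T ?R
  proof -
    from that obtain m i where m: "m \<in> {1..k}" "c = a m" and i: "i \<in> {1..k}" "u i \<le> c" "c < a i" by auto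
    have "u i \<noteq> c" using flow_source[OF F i(1) m(1)] i m by auto
    then have "u m = c" using flow_between[OF F i(1) m(1)] i m by auto
    then have ?B using imageI[OF m(1), of u] by simp
    moreover have ?L using i \<open>u i \<noteq> c\<close> by (intro bexI[of _ i]) auto
    ultimately show ?thesis ..
  qed
  show "has_top t \<longleftrightarrow> ?T" "has_right t \<longleftrightarrow> ?R" by (simp_all add: t flow_tile_def)
  show "has_bot t \<longleftrightarrow> ?B"
    unfolding t bot using BR TR by argo
  have TB: ?L if ?T "\<not> ?B"
  proof -
    from that obtain i where i: "i \<in> {1..k}" "c = a i" by auto
    then have "u i \<noteq> a i" using that imageI[OF i(1), of u] by metis
    then show ?thesis using i flow_le[OF F i(1)] by (intro bexI[of _ i]) auto
  qed
  have RB: ?L if ?R "\<not> ?B"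
  proof -
    from that obtain i where i: "i \<in> {1..k}" "u i \<le> c" "c < a i" by auto
    then have "u i \<noteq> c" using that imageI[OF i(1), of u] by metis
    then show ?thesis using i by (intro bexI[of _ i]) auto
  qed
  have L: "?T \<and> (?R \<or> \<not> ?B) \<or> \<not> ?T \<and> ?R \<and> \<not> ?B" if ?L
  proof -
    from that obtain i where i: "i \<in> {1..k}" "u i < c" "c \<le> a i" by auto
    show ?thesis
    proof (cases "c = a i")
      case True
      then have "\<not> ?B" using flow_target[OF F a i(1)] i(2) by (metis image_iff)
      then show ?thesis using True i by auto
    next
      case False
      then have R: ?R using i by (intro bexI[of _ i]) auto
      \<comment> \<open>Such an exit would be the end of a second run, overlapping the
        first.\<close>
      have "\<not> ?B" if "\<not> ?T"
      proof
        assume ?B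
        then obtain m where m: "m \<in> {1..k}" "c = u m" by auto
        then have "u m \<noteq> a m" using that imageI[OF m(1), of a] by metis
        then have "u m < a m" using flow_le[OF F m(1)] by simp
        then show False using flow_disjoint[OF F a i(1) m(1)] i m False by auto
      qed
      then show ?thesis using R by blast
    qed
  qed
  show "has_left t \<longleftrightarrow> ?L"
    unfolding t left using TR TB RB L by argo
qed

lemma perm_seq_Sdec: "perm_seq n U \<Longrightarrow> k \<le> n \<Longrightarrow> U k \<in> Sdec n k"
  by (simp add: perm_seq_def)

lemma perm_seq_pieri: "perm_seq n U \<Longrightarrow> k \<in> {1..n} \<Longrightarrow> pieri k (U k) (U (k - 1))"
  by (simp add: perm_seq_def)

lemma perm_seq_range: "perm_seq n U \<Longrightarrow> k \<le> n \<Longrightarrow> i \<in> {1..n} \<Longrightarrow> U k i \<in> {1..n}"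
  using permutes_in_image[OF Sdec_permutes[OF perm_seq_Sdec]] by blast

lemma perm_seq_entry_pieri:
  assumes U: "perm_seq n U" and r: "r \<in> {1..n}"
  shows "pieri r (U r) (entry n U r)"
proof -
  have "U (r - 1) \<in> Sdec n (r - 1)" "U r permutes {1..n}"
    using perm_seq_Sdec[OF U, of "r - 1"] Sdec_permutes[OF perm_seq_Sdec[OF U, of r]] r by auto
  then show ?thesis using perm_seq_pieri[OF U r] pieri_entry_iff[of "U (r - 1)" n r "U r"] r
    by (simp add: entry_def)
qed

lemma perm_seq_entry_inj:
  assumes U: "perm_seq n U" and r: "r \<in> {1..n}"
  shows "inj_on (entry n U r) {1..r}"
proof (rule inj_on_entry)
  show "inj_on (U (r - 1)) {1..<r}"
    by (rule permutes_inj_on[OF Sdec_permutes[OF perm_seq_Sdec[OF U]]]) (use r in auto)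
  fix i assume "i \<in> {1..<r}"
  then show "U (r - 1) i \<le> n" using perm_seq_range[OF U, of "r - 1" i] r by auto
qed

lemma flow_fill_eq_tile:
  assumes "r \<in> {1..n}" "c \<in> {1..n}"
  shows "flow_fill n U r c = flow_tile (c \<in> entry n U r ` {1..r}) (c \<in> U r ` {1..r})
    (\<exists>i\<in>{1..r}. U r i \<le> c \<and> c < entry n U r i)"
proof -
  have "{1..r} = insert r {1..<r}" using assms by auto
  then have "entry n U r ` {1..r} = insert (Suc n) (entry n U r ` {1..<r})" by simp
  also have "entry n U r ` {1..<r} = U (r - 1) ` {1..<r}" by (intro image_cong) auto
  finally show ?thesis using assms by (simp add: flow_fill_def)
qed

lemma perm_seq_matched:
  assumes U: "perm_seq n U"
  shows "matched n (flow_fill n U)"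
proof -
  let ?D = "flow_fill n U"
  note F = perm_seq_entry_pieri[OF U, unfolded pieri_def, THEN conjunct1]
  note edges = flow_tile_edges[OF F perm_seq_entry_inj[OF U] flow_fill_eq_tile]
  have top: "has_top (?D r c) \<longleftrightarrow> c \<in> U (r - 1) ` {1..<r}" if "r \<in> {1..n}" "c \<in> {1..n}" for r c
    using that by (simp add: flow_fill_def flow_tile_def)
  show ?thesis
    unfolding matched_def
  proof (intro conjI ballI allI impI)
    fix r c assume "\<not> (1 \<le> r \<and> r \<le> n \<and> 1 \<le> c \<and> c \<le> n)"
    then show "?D r c = Blank" by (auto simp: flow_fill_def)
  next
    fix r c assume rc: "r \<in> {1..n}" "c \<in> {1..<n}"
    then have c: "c \<in> {1..n}" "Suc c \<in> {1..n}" by auto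
    show "has_right (?D r c) = has_left (?D r (c + 1))"
      using edges(3)[OF rc(1,1,1) c(1)] edges(4)[OF rc(1,1,1) c(2)] by (simp add: less_Suc_eq_le Suc_le_eq)
  next
    fix r c assume rc: "r \<in> {1..<n}" "c \<in> {1..n}"
    then have r: "r \<in> {1..n}" "Suc r \<in> {1..n}" by auto
    show "has_bot (?D r c) = has_top (?D (r + 1) c)"
      using edges(2)[OF r(1,1,1) rc(2)] top[OF r(2) rc(2)]
      by (simp add: atLeastLessThanSuc_atLeastAtMost)
  next
    fix r assume r: "r \<in> {1..n}"
    then have c: "1 \<in> {1..n}" by auto
    have "\<not> U r i < 1" if "i \<in> {1..r}" for i using perm_seq_range[OF U, of r i] r that by auto
    then show "\<not> has_left (?D r 1)" using edges(4)[OF r r r c] by blast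
  next
    fix c assume "c \<in> {1..n}"
    then show "\<not> has_top (?D 1 c)" using top[of 1 c] by simp
  next
    fix r assume r: "r \<in> {1..n}"
    then have "n \<in> {1..n}" by auto
    \<comment> \<open>Pipe r, started in the virtual column, opens the edge on the right
      boundary.\<close>
    moreover have "U r r \<le> n" using perm_seq_range[OF U, of r r] r by auto
    ultimately show "has_right (?D r n)" using edges(3)[OF r r r, of n] r by (force intro!: bexI[of _ r])
  qed
qed

lemma perm_seq_row_traced:
  assumes U: "perm_seq n U" and r: "r \<in> {1..n}"
  shows "row_traced n (flow_fill n U) U r"
  unfolding row_traced_def
proof (intro ballI)
  fix i assume i: "i \<in> {1..r}"
  let ?u = "U r" and ?a = "entry n U r" and ?D = "flow_fill n U"
  have F: "flow r ?u ?a" using perm_seq_entry_pieri[OF U r] by (simp add: pieri_def)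
  note inj = perm_seq_entry_inj[OF U r]
  note edges = flow_tile_edges[OF F inj flow_fill_eq_tile[OF r]]
  have u: "?u i \<in> {1..n}" using perm_seq_range[OF U, of r i] i r by auto
  have a: "?a i \<le> Suc n" "1 \<le> ?a i"
    using perm_seq_range[OF U, of "r - 1" i] i r by (cases "i = r"; force)+
  have "?D r (?u i) \<in> {Vert, Cross}" if "?u i = ?a i"
  proof -
    have "has_top (?D r (?u i))" "has_bot (?D r (?u i))"
      using edges(1,2)[OF u] imageI[OF i, of ?a] imageI[OF i, of ?u] that by metis+
    then show ?thesis by (cases "?D r (?u i)") auto
  qed
  moreover have "?D r (?u i) = ElbowRB" if lt: "?u i < ?a i"
  proof -
    have "\<not> has_top (?D r (?u i))" using edges(1)[OF u] flow_source[OF F i _ lt] by blast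
    moreover have "has_bot (?D r (?u i))" using edges(2)[OF u] imageI[OF i] by blast
    moreover have "has_right (?D r (?u i))" using edges(3)[OF u] i lt by blast
    ultimately show ?thesis by (cases "?D r (?u i)") auto
  qed
  moreover have "?D r (?a i) = ElbowTL" if lt: "?u i < ?a i" and an: "?a i \<le> n"
  proof -
    have an': "?a i \<in> {1..n}" using an a by simp
    have "has_top (?D r (?a i))" using edges(1)[OF an'] imageI[OF i] by blast
    moreover have "\<not> has_bot (?D r (?a i))"
      using edges(2)[OF an'] flow_target[OF F inj i _ lt] by fastforce
    ultimately show ?thesis by (cases "?D r (?a i)") auto
  qed
  moreover have "?D r c \<in> {Horiz, Cross}" if c: "?u i < c" "c < ?a i" for c
  proof -
    have c': "c \<in> {1..n}" using c a by auto
    have "has_right (?D r c)" using edges(3)[OF c'] i c by (auto intro!: bexI[of _ i])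
    moreover have "has_left (?D r c)" using edges(4)[OF c'] i c by (auto intro!: bexI[of _ i])
    ultimately show ?thesis by (cases "?D r c") auto
  qed
  ultimately show "1 \<le> ?u i \<and> ?u i \<le> n \<and> ?u i \<le> ?a i \<and> ?a i \<le> Suc n \<and>
     (?u i = ?a i \<longrightarrow> ?D r (?u i) \<in> {Vert, Cross}) \<and>
     (?u i < ?a i \<longrightarrow> ?D r (?u i) = ElbowRB \<and>
        (?a i \<le> n \<longrightarrow> ?D r (?a i) = ElbowTL) \<and>
        (\<forall>c. ?u i < c \<longrightarrow> c < ?a i \<longrightarrow> ?D r c \<in> {Horiz, Cross}))"
    using u a flow_le[OF F i] by simp
qed

section \<open>Passing between pipe dreams and sequences\<close>

lemma pipe_exit_first_rows:
  assumes T: "\<And>r. r \<in> {1..n} \<Longrightarrow> row_traced n D E r" and "k \<le> n" "i \<in> {1..k}"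
  shows "pipe_exit n k (first_rows k D) i = E k i"
proof (rule pipe_exit_traced[OF _ assms(3)])
  fix r assume "r \<in> {1..k}"
  then have "row_traced n D E r" "first_rows k D r = D r"
    using T assms(2) by (auto simp: first_rows_def)
  then show "row_traced n (first_rows k D) E r"
    using row_traced_cong[of r E E "first_rows k D" D n] by simp
qed

lemma assoc_perm_eqI:
  assumes "u \<in> Sdec n k" "\<And>i. i \<in> {1..k} \<Longrightarrow> u i = pipe_exit n k D i"
  shows "assoc_perm n k D = u"
  unfolding assoc_perm_def
  by (rule the_equality) (use assms in \<open>auto intro!: Sdec_unique[of _ n k u]\<close>)

lemma perm_seq_kBPD:
  assumes U: "perm_seq n U"
  shows "kBPD n n (flow_fill n U)"
  unfolding kBPD_iff_matched
proof (intro conjI allI impI)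
  show "matched n (flow_fill n U)" by (rule perm_seq_matched[OF U])
  fix i m assume "1 \<le> i" "i < m" "m \<le> n"
  then show "card (crossings n n (flow_fill n U) i m) \<le> 1"
    by (intro few_crossings_of_pieri[where E = U] perm_seq_row_traced[OF U] perm_seq_entry_inj[OF U] perm_seq_entry_pieri[OF U])
qed

lemma perm_seq_assoc_perm:
  assumes U: "perm_seq n U" and k: "k \<le> n"
  shows "assoc_perm n k (first_rows k (flow_fill n U)) = U k"
  by (rule assoc_perm_eqI[OF perm_seq_Sdec[OF U k]])
     (rule pipe_exit_first_rows[OF perm_seq_row_traced[OF U] k, symmetric])

text \<open>\<open>exits\<close> gives the columns of the first k pipes and \<open>ex_Sdec\<close>
  completes them to the permutation \<open>U k\<close>. From then on \<open>U\<close> replaces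
  \<open>exits\<close> as the trajectory.\<close>

lemma kBPD_perm_seq:
  assumes D: "kBPD n n D"
  defines "U \<equiv> \<lambda>k. assoc_perm n k (first_rows k D)"
  shows "perm_seq n U" "D = flow_fill n U"
proof -
  let ?E = "exits n D"
  have M: "matched n D" using D by (simp add: kBPD_iff_matched)
  note TE = matched_row_traced[OF M]
  have U: "U k \<in> Sdec n k \<and> (\<forall>i\<in>{1..k}. U k i = ?E k i)" if k: "k \<le> n" for k
  proof -
    have "?E k ` {1..k} \<subseteq> {1..n}"
    proof safe
      fix i assume "i \<in> {1..k}"
      then show "?E k i \<in> {1..n}" using row_tracedD(1,2)[OF TE[of k]] k by auto
    qed
    then obtain u where u: "u \<in> Sdec n k" "\<forall>i\<in>{1..k}. u i = ?E k i"
      using ex_Sdec[OF traced_inj[OF TE k] _ k] by blast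
    have "U k = u" unfolding U_def
      by (rule assoc_perm_eqI[OF u(1)]) (use u pipe_exit_first_rows[OF TE k] in simp)
    then show ?thesis using u by simp
  qed
  have T: "row_traced n D U r" if "r \<in> {1..n}" for r
  proof -
    \<comment> \<open>Only the pipes present in row r and in the row above matter, and on these the
      two families agree.\<close>
    have "row_traced n D U r \<longleftrightarrow> row_traced n D ?E r"
    proof (rule row_traced_cong)
      show "U r i = ?E r i" if "i \<in> {1..r}" for i using U[of r] \<open>r \<in> {1..n}\<close> that by auto
      show "U (r - 1) i = ?E (r - 1) i" if "i \<in> {1..<r}" for i
        using U[of "r - 1"] \<open>r \<in> {1..n}\<close> that by auto
    qed simp
    then show ?thesis using TE[OF that] by simp
  qed
  have inj: "inj_on (entry n U r) {1..r}" if r: "r \<in> {1..n}" for r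
  proof (rule inj_on_entry)
    have "r - 1 \<le> n" using r by auto
    then have "U (r - 1) permutes {1..n}" using U Sdec_permutes by blast
    then show "inj_on (U (r - 1)) {1..<r}" by (rule permutes_inj_on)
    fix i assume "i \<in> {1..<r}"
    then show "U (r - 1) i \<le> n" using row_tracedD(2)[OF T[of "r - 1"], of i] r by auto
  qed
  have "pieri r (U r) (U (r - 1))" if r: "r \<in> {1..n}" for r
  proof -
    have "pieri r (U r) (entry n U r)"
      by (rule pieri_of_few_crossings[OF T inj _ r]) (use D in \<open>simp_all add: kBPD_iff_matched\<close>)
    then show ?thesis
      using pieri_entry_iff[of "U (r - 1)" n r "U r"] U[of "r - 1"] U[of r] r Sdec_permutes[of "U r" n r]
      by (simp add: entry_def)
  qed
  then show "perm_seq n U" using U by (auto simp: perm_seq_def)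
  show "D = flow_fill n U" by (rule matched_eq_flow_fill[OF M T])
qed

lemma flow_fill_cong:
  assumes "\<And>k. k \<le> n \<Longrightarrow> E k = E' k"
  shows "flow_fill n E = flow_fill n E'"
proof (intro ext)
  fix r c
  have "r \<in> {1..n} \<Longrightarrow> E r = E' r \<and> E (r - 1) = E' (r - 1)" using assms[of r] assms[of "r - 1"] by auto
  then show "flow_fill n E r c = flow_fill n E' r c" by (simp add: flow_fill_def entry_def)
qed

section \<open>Lengths and blank tiles\<close>

lemma perm_seq_inc_chain:
  assumes U: "perm_seq n U" and k: "k \<in> {1..n}"
  shows "inc_chain n k 0 (U k) (U (k - 1))"
    and "perm_len n (U (k - 1)) = perm_len n (U k) +
      card {c \<in> U (k - 1) ` {k<..n}. \<exists>i\<in>{1..k}. U k i \<le> c \<and> c < U (k - 1) i}"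
proof -
  have "U k \<in> Sdec n k" "U (k - 1) \<in> Sdec n k"
    using perm_seq_Sdec[OF U, of k] Sdec_mono[OF perm_seq_Sdec[OF U, of "k - 1"], of k] k by auto
  then show "inc_chain n k 0 (U k) (U (k - 1))"
    and "perm_len n (U (k - 1)) = perm_len n (U k) +
      card {c \<in> U (k - 1) ` {k<..n}. \<exists>i\<in>{1..k}. U k i \<le> c \<and> c < U (k - 1) i}"
    using pieri_imp_inc_chain[OF _ _ perm_seq_pieri[OF U k], of n 0] k by auto
qed

text \<open>The columns not entered from above are the values of v from position k on. Column v k
  always carries pipe k; each of the other n - k columns is blank unless a horizontal run uses its
  right edge, and those used are the ones counted by the length difference.\<close>

lemma perm_seq_blank_count:
  assumes U: "perm_seq n U" and k: "k \<in> {1..n}"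
  shows "perm_len n (U (k - 1)) + card {c \<in> {1..n}. flow_fill n U k c = Blank} = perm_len n (U k) + (n - k)"
proof -
  let ?v = "U (k - 1)" and ?u = "U k"
  let ?T = "{c \<in> ?v ` {k<..n}. \<exists>i\<in>{1..k}. ?u i \<le> c \<and> c < ?v i}"
  have S: "?v \<in> Sdec n (k - 1)" using perm_seq_Sdec[OF U, of "k - 1"] k by auto
  note pv = Sdec_permutes[OF S]
  have le: "?u k \<le> ?v k" using pieri_le[OF perm_seq_pieri[OF U k], of k] k by simp
  have kn: "?v k \<le> n" using perm_seq_range[OF U, of "k - 1" k] k by auto
  \<comment> \<open>Tail values lie below v k, so it makes no difference whether pipe k starts in
    column v k or in the virtual column.\<close>
  have right: "(\<exists>i\<in>{1..k}. ?u i \<le> c \<and> c < entry n U k i) \<longleftrightarrow> (\<exists>i\<in>{1..k}. ?u i \<le> c \<and> c < ?v i)"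
    if c: "c \<in> ?v ` {k<..n}" for c
  proof -
    have "c < ?v k" using c Sdec_less[OF S, of k] k by auto
    then have "c < entry n U k i \<longleftrightarrow> c < ?v i" if "i \<in> {1..k}" for i
      using that kn by (cases "i = k") auto
    then show ?thesis by auto
  qed
  have blank: "{c \<in> {1..n}. flow_fill n U k c = Blank} = ?v ` {k<..n} - ?T"
  proof (intro set_eqI iffI)
    fix c assume "c \<in> {c \<in> {1..n}. flow_fill n U k c = Blank}"
    then have c: "c \<in> {1..n}" "c \<notin> ?v ` {1..<k}" "\<not> (\<exists>i\<in>{1..k}. ?u i \<le> c \<and> c < entry n U k i)"
      using k by (auto simp: flow_fill_def flow_tile_def split: if_splits)
    have "c \<in> ?v ` {1..n}" using c permutes_image[OF pv] by simp
    then obtain j where j: "j \<in> {1..n}" "c = ?v j" by auto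
    have "j \<noteq> k"
    proof
      assume "j = k"
      then have "?u k \<le> c" "c < entry n U k k" using le j kn by auto
      then show False using c(3) k by auto
    qed
    moreover have "\<not> j < k" using c(2) j by auto
    ultimately have "c \<in> ?v ` {k<..n}" using j by auto
    then show "c \<in> ?v ` {k<..n} - ?T" using c(3) right by blast
  next
    fix c assume c: "c \<in> ?v ` {k<..n} - ?T"
    then obtain j where j: "j \<in> {k<..n}" "c = ?v j" by auto
    have cn: "c \<in> {1..n}" using j permutes_in_image[OF pv, of j] by auto
    have "c \<notin> ?v ` {1..<k}" using j permutes_eq_iff[OF pv] by auto
    moreover have "\<not> (\<exists>i\<in>{1..k}. ?u i \<le> c \<and> c < entry n U k i)" using c right by blast
    ultimately show "c \<in> {c \<in> {1..n}. flow_fill n U k c = Blank}"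
      using cn k by (simp add: flow_fill_def flow_tile_def)
  qed
  have "card (?v ` {k<..n} - ?T) = card (?v ` {k<..n}) - card ?T"
    by (rule card_Diff_subset) auto
  moreover have "card ?T \<le> card (?v ` {k<..n})" by (rule card_mono) auto
  moreover have "card (?v ` {k<..n}) = n - k"
    using card_image[OF permutes_inj_on[OF pv], of "{k<..n}"] by simp
  ultimately show ?thesis unfolding blank using perm_seq_inc_chain(2)[OF U k] by linarith
qed

section \<open>Chains to the longest element as sequences\<close>

lemma w0_Sdec: "w0 n \<in> Sdec n 0"
proof -
  have "bij_betw (w0 n) {1..n} {1..n}"
    by (rule bij_betw_byWitness[of _ "w0 n"]) (auto simp: w0_def)
  then have "w0 n permutes {1..n}" by (rule bij_imp_permutes) (auto simp: w0_def)
  then show ?thesis by (auto simp: Sdec_def w0_def)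
qed

lemma perm_seq_ends:
  assumes U: "perm_seq n U" and n: "n \<ge> 1"
  shows "U 0 = w0 n" "U (n - 1) = U n"
proof -
  show "U 0 = w0 n" using Sdec_unique[OF perm_seq_Sdec[OF U, of 0] w0_Sdec] by simp
  have "inc_chain n n 0 (U n) (U (n - 1))" using perm_seq_inc_chain(1)[OF U, of n] n by simp
  \<comment> \<open>For k = n there is no position j with n < j \<le> n, so the chain has no
    step.\<close>
  then show "U (n - 1) = U n" by cases auto
qed

lemma rev_upt_nth: "s < n \<Longrightarrow> rev [0..<n] ! s = n - 1 - s" "s < n - 1 \<Longrightarrow> rev [1..<n] ! s = n - 1 - s"
  by (auto simp: rev_nth)

lemma compatible_descending_iff:
  assumes n: "n \<ge> 1"
  shows "compatible n (map U (rev [0..<n])) (rev [1..<n]) \<longleftrightarrow>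
    (\<forall>k<n. U k permutes {1..n}) \<and> (\<forall>k\<in>{1..<n}. inc_chain n k 0 (U k) (U (k - 1)))"
proof -
  \<comment> \<open>Step s of the list belongs to k = n - 1 - s.\<close>
  have "(\<forall>s < n - 1. inc_chain n (n - 1 - s) 0 (U (n - 1 - s)) (U (n - 1 - Suc s))) \<longleftrightarrow>
      (\<forall>k\<in>{1..<n}. inc_chain n k 0 (U k) (U (k - 1)))" (is "?L \<longleftrightarrow> ?R")
  proof
    assume L: ?L
    show ?R
    proof
      fix k assume k: "k \<in> {1..<n}"
      then have "n - 1 - (n - 1 - k) = k" "n - 1 - Suc (n - 1 - k) = k - 1" "n - 1 - k < n - 1" by auto
      then show "inc_chain n k 0 (U k) (U (k - 1))" using L by metis
    qed
  next
    assume R: ?R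
    show ?L
    proof (intro allI impI)
      fix s assume "s < n - 1"
      then have "n - 1 - s \<in> {1..<n}" "n - 1 - Suc s = n - 1 - s - 1" by auto
      then show "inc_chain n (n - 1 - s) 0 (U (n - 1 - s)) (U (n - 1 - Suc s))" using R by metis
    qed
  qed
  moreover have "map U (rev [0..<n]) ! s = U (n - 1 - s)" if "s < n" for s
    using that rev_upt_nth(1) by simp
  moreover have "compatible n (map U (rev [0..<n])) (rev [1..<n]) \<longleftrightarrow>
      (\<forall>k<n. U k permutes {1..n}) \<and>
      (\<forall>s < n - 1. inc_chain n (rev [1..<n] ! s) 0 (map U (rev [0..<n]) ! s) (map U (rev [0..<n]) ! (s + 1)))"
    unfolding compatible_def inc_chain_iff_inc_kchain using n by auto
  moreover have "(\<forall>s < n - 1. inc_chain n (rev [1..<n] ! s) 0 (map U (rev [0..<n]) ! s) (map U (rev [0..<n]) ! (s + 1)))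
      \<longleftrightarrow> (\<forall>s < n - 1. inc_chain n (n - 1 - s) 0 (U (n - 1 - s)) (U (n - 1 - Suc s)))"
    using calculation(2) rev_upt_nth(2)[of _ n] by auto
  ultimately show ?thesis by simp
qed

text \<open>A chain merely consists of permutations. That each decreases behind its position k is
  deduced from \<open>w0\<close> backwards, since \<open>inc_chain_imp_pieri\<close> carries this
  property from the end of an increasing chain to its beginning.\<close>

lemma chains_to_w0_eq:
  assumes n: "n \<ge> 1"
  shows "chains_to_w0 n w = {map U (rev [0..<n]) | U. perm_seq n U \<and> U n = w}"
proof (intro set_eqI iffI)
  fix ws assume "ws \<in> {map U (rev [0..<n]) | U. perm_seq n U \<and> U n = w}"
  then obtain U where U: "perm_seq n U" "U n = w" and ws: "ws = map U (rev [0..<n])" by auto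
  have "U k permutes {1..n}" if "k < n" for k
    using Sdec_permutes[OF perm_seq_Sdec[OF U(1)]] that by simp
  then have "compatible n ws (rev [1..<n])"
    unfolding ws compatible_descending_iff[OF n] using perm_seq_inc_chain(1)[OF U(1)] by auto
  moreover have "hd ws = w" using perm_seq_ends[OF U(1) n] U(2) n by (simp add: ws hd_map hd_rev last_upt)
  moreover have "last ws = w0 n" using perm_seq_ends[OF U(1) n] n by (simp add: ws last_map last_rev hd_upt)
  ultimately show "ws \<in> chains_to_w0 n w" by (simp add: chains_to_w0_def)
next
  fix ws assume "ws \<in> chains_to_w0 n w"
  then have ws: "compatible n ws (rev [1..<n])" "hd ws = w" "last ws = w0 n" by (auto simp: chains_to_w0_def)
  then have len: "length ws = n" using n by (simp add: compatible_def)
  \<comment> \<open>The list has no member for k = n; repeating w there adds a trivial chain from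
    \<open>U n\<close> to \<open>U (n - 1)\<close>.\<close>
  define U where "U k = (if k < n then ws ! (n - 1 - k) else w)" for k
  have eq: "ws = map U (rev [0..<n])"
    by (rule nth_equalityI) (use len in \<open>auto simp: U_def rev_upt_nth\<close>)
  have ends: "U (n - 1) = w" "U 0 = w0 n"
  proof -
    have "ws \<noteq> []" using len n by auto
    then show "U (n - 1) = w" "U 0 = w0 n"
      using ws(2,3) len n hd_conv_nth[of ws] last_conv_nth[of ws] by (simp_all add: U_def)
  qed
  have chain: "inc_chain n k 0 (U k) (U (k - 1))" if "k \<in> {1..<n}" for k
    using ws(1) that unfolding eq compatible_descending_iff[OF n] by blast
  have perm: "U k permutes {1..n}" if "k < n" for k
    using ws(1) that unfolding eq compatible_descending_iff[OF n] by blast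
  have step: "U k \<in> Sdec n k \<and> pieri k (U k) (U (k - 1))"
    if "inc_chain n k 0 (U k) (U (k - 1))" "U (k - 1) \<in> Sdec n (k - 1)" for k
    using inc_chain_imp_pieri[OF that(1)] Sdec_mono[OF that(2), of k] by simp
  have S: "U k \<in> Sdec n k" if "k < n" for k
    using that
  proof (induction k)
    case 0
    then show ?case using w0_Sdec ends by simp
  next
    case (Suc k)
    then show ?case using step[of "Suc k"] chain[of "Suc k"] by simp
  qed
  have "U n = U (n - 1)" using ends by (simp add: U_def)
  then have "inc_chain n n 0 (U n) (U (n - 1))" using perm[of "n - 1"] n by (simp add: inc_chain.refl)
  then have "inc_chain n k 0 (U k) (U (k - 1))" if "k \<in> {1..n}" for k
    using chain[of k] that by (cases "k = n") auto
  then have P: "U k \<in> Sdec n k \<and> pieri k (U k) (U (k - 1))" if "k \<in> {1..n}" for k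
    using step[of k] S[of "k - 1"] that by fastforce
  have "perm_seq n U"
    unfolding perm_seq_def
  proof (intro conjI allI impI ballI)
    fix k assume "k \<le> n"
    then show "U k \<in> Sdec n k" using P[of k] S[of 0] n by (cases "k = 0") auto
  qed (use P in blast)
  moreover have "U n = w" by (simp add: U_def)
  ultimately show "ws \<in> {map U (rev [0..<n]) | U. perm_seq n U \<and> U n = w}" using eq by blast
qed

section \<open>The bijection and the weights\<close>

lemma first_rows_all: "kBPD n n D \<Longrightarrow> first_rows n D = D"
  by (auto simp: kBPD_def first_rows_def fun_eq_iff)

theorem theorem3p6:
  fixes n :: nat and w :: "nat \<Rightarrow> nat"
  assumes "n \<ge> 1" and "w permutes {1..n}"
  shows "bij_betw (chainBPD n) (BPD n w) (chains_to_w0 n w) \<and>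
         (\<forall>D\<in>BPD n w. chain_wt n (chainBPD n D) =
             rev (map2 (\<lambda>a b. a - b) (map int (rev [1..<n])) (bpd_wt n D)))"
proof -
  note n = assms(1)
  \<comment> \<open>Unlike \<open>chainBPD\<close>, this family includes the member k = n.\<close>
  define V where "V D = (\<lambda>k. assoc_perm n k (first_rows k D))" for D
  have chain: "chainBPD n D = map (V D) (rev [0..<n])" for D by (simp add: chainBPD_def V_def)
  have V: "perm_seq n (V D)" "D = flow_fill n (V D)" "V D n = w" if "D \<in> BPD n w" for D
  proof -
    have D: "kBPD n n D" "assoc_perm n n D = w" using that by (auto simp: BPD_def)
    show "perm_seq n (V D)" "D = flow_fill n (V D)"
      unfolding V_def by (rule kBPD_perm_seq[OF D(1)])+
    show "V D n = w" using D by (simp add: V_def first_rows_all)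
  qed
  have VU: "V (flow_fill n U) k = U k" if "perm_seq n U" "k \<le> n" for U k
    unfolding V_def by (rule perm_seq_assoc_perm[OF that])
  have "inj_on (chainBPD n) (BPD n w)"
  proof (rule inj_onI)
    fix D D' assume D: "D \<in> BPD n w" "D' \<in> BPD n w" "chainBPD n D = chainBPD n D'"
    have "V D k = V D' k" if "k \<le> n" for k
    proof (cases "k = n")
      case True
      \<comment> \<open>The member k = n is not in the list, but it equals w on both sides.\<close>
      then show ?thesis using V(3) D by simp
    next
      case False
      then show ?thesis using D(3) that by (auto simp: chain)
    qed
    then have "flow_fill n (V D) = flow_fill n (V D')" by (rule flow_fill_cong)
    then show "D = D'" using V(2) D by metis
  qed
  moreover have "chainBPD n ` BPD n w = chains_to_w0 n w"
  proof (intro set_eqI iffI)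
    fix ws assume "ws \<in> chainBPD n ` BPD n w"
    then obtain D where "D \<in> BPD n w" "ws = map (V D) (rev [0..<n])" by (auto simp: chain)
    then show "ws \<in> chains_to_w0 n w" unfolding chains_to_w0_eq[OF n] using V by blast
  next
    fix ws assume "ws \<in> chains_to_w0 n w"
    then obtain U where U: "perm_seq n U" "U n = w" "ws = map U (rev [0..<n])"
      unfolding chains_to_w0_eq[OF n] by auto
    let ?D = "flow_fill n U"
    have K: "kBPD n n ?D" by (rule perm_seq_kBPD[OF U(1)])
    then have "assoc_perm n n ?D = w" using VU[OF U(1), of n] U(2) by (simp add: V_def first_rows_all)
    then have "?D \<in> BPD n w" using K by (simp add: BPD_def)
    moreover have "chainBPD n ?D = ws" using VU[OF U(1)] by (simp add: chain U(3))
    ultimately show "ws \<in> chainBPD n ` BPD n w" by blast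
  qed
  moreover have "chain_wt n (chainBPD n D) =
      rev (map2 (\<lambda>a b. a - b) (map int (rev [1..<n])) (bpd_wt n D))" if D: "D \<in> BPD n w" for D
  proof (rule nth_equalityI)
    show "length (chain_wt n (chainBPD n D)) =
        length (rev (map2 (\<lambda>a b. a - b) (map int (rev [1..<n])) (bpd_wt n D)))"
      by (simp add: chain_wt_def chain bpd_wt_def)
    fix s assume "s < length (chain_wt n (chainBPD n D))"
    then have s: "s < n - 1" by (simp add: chain_wt_def chain)
    \<comment> \<open>The row whose blank tiles are compared with step s of the chain.\<close>
    define k where "k = n - 1 - s"
    have k: "k \<in> {1..n}" "k < n" using s by (auto simp: k_def)
    have l: "chain_wt n (chainBPD n D) ! s = int (perm_len n (V D (k - 1))) - int (perm_len n (V D k))"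
    proof -
      have "n - 1 - (s + 1) = k - 1" by (simp add: k_def)
      then have "map (V D) (rev [0..<n]) ! s = V D k" "map (V D) (rev [0..<n]) ! (s + 1) = V D (k - 1)"
        using s rev_upt_nth(1)[of s n] rev_upt_nth(1)[of "s + 1" n] by (simp_all add: k_def)
      then show ?thesis using s by (simp add: chain_wt_def chain)
    qed
    have r: "rev (map2 (\<lambda>a b. a - b) (map int (rev [1..<n])) (bpd_wt n D)) ! s =
        int (n - k) - int (card {c \<in> {1..n}. D k c = Blank})"
    proof -
      have lens: "length (map2 (\<lambda>a b. a - b) (map int (rev [1..<n])) (bpd_wt n D)) = n - 1"
        by (simp add: bpd_wt_def)
      have "rev (map2 (\<lambda>a b. a - b) (map int (rev [1..<n])) (bpd_wt n D)) ! s =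
          map2 (\<lambda>a b. a - b) (map int (rev [1..<n])) (bpd_wt n D) ! (k - 1)"
        using s k lens by (subst rev_nth) (auto simp: k_def)
      also have "\<dots> = int (rev [1..<n] ! (k - 1)) - bpd_wt n D ! (k - 1)"
        using k by (subst nth_map) (auto simp: bpd_wt_def)
      also have "rev [1..<n] ! (k - 1) = n - k" using k by (subst rev_upt_nth(2)) auto
      also have "bpd_wt n D ! (k - 1) = int (card {c \<in> {1..n}. D k c = Blank})"
        using k nth_upt[of 1 "k - 1" n] by (simp add: bpd_wt_def)
      finally show ?thesis .
    qed
    have "perm_len n (V D (k - 1)) + card {c \<in> {1..n}. D k c = Blank} = perm_len n (V D k) + (n - k)"
      using perm_seq_blank_count[OF V(1)[OF D] k(1)] V(2)[OF D] by metis
    then show "chain_wt n (chainBPD n D) ! s =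
        rev (map2 (\<lambda>a b. a - b) (map int (rev [1..<n])) (bpd_wt n D)) ! s"
      unfolding l r by linarith
  qed
  ultimately show ?thesis unfolding bij_betw_def by blast
qed

end
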